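(* Let $k\geq 2$ and let $C$ be the centipede obtained from the path $P_k$ by appending one pendant vertex to each vertex of degree $2$ of $P_k$ (so $C$ has $n=2k-2$ vertices). If $G$ is any finite simple graph whose Laplacian matrix has the same spectrum (with multiplicities) as the Laplacian matrix of $C$, then $G$ is isomorphic to $C$. That is, the centipede is determined by its Laplacian spectrum.
   Context: Graphs are finite, simple and undirected. The Laplacian of a graph is $L=D-A$, where $A$ is the adjacency matrix and $D$ is the diagonal matrix of vertex degrees. $P_k$ denotes the path on $k$ vertices. A centipede is a tree obtained by appending a pendant vertex (a new vertex of degree $1$) to each vertex of degree $2$ of a path. *)

theory Defs
  imports
    "Graph_Theory.Digraph_Isomorphism"
    "Graph_Theory.Pair_Digraph"
    "Jordan_Normal_Form.Char_Poly"
    "HOL-Computational_Algebra.Fundamental_Theorem_Algebra"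
begin

text \<open>
  Finite simple undirected graphs are the finite, loop-free, symmetric digraphs without parallel
  arcs of the locale \<^locale>\<open>graph\<close>: an undirected edge is a pair of opposite arcs, so the degree of
  a vertex is its out-degree.
\<close>

section \<open>Laplacian matrix and spectrum\<close>

text \<open>The matrices are taken with respect to a list of the vertices, which orders rows and columns.\<close>

definition adjacency_matrix :: "('a, 'b) pre_digraph \<Rightarrow> 'a list \<Rightarrow> real mat" where
  "adjacency_matrix G vs = mat (length vs) (length vs)
     (\<lambda>(i, j). if vs ! i \<rightarrow>\<^bsub>G\<^esub> vs ! j then 1 else 0)"

definition degree_matrix :: "('a, 'b) pre_digraph \<Rightarrow> 'a list \<Rightarrow> real mat" where
  "degree_matrix G vs = mat (length vs) (length vs)
     (\<lambda>(i, j). if i = j then real (out_degree G (vs ! i)) else 0)"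

definition laplacian_matrix :: "('a, 'b) pre_digraph \<Rightarrow> 'a list \<Rightarrow> real mat" where
  "laplacian_matrix G vs = degree_matrix G vs - adjacency_matrix G vs"

text \<open>
  The multiset of eigenvalues with algebraic multiplicities. It is taken over the complex numbers,
  where the characteristic polynomial splits.
\<close>

definition mat_spectrum :: "real mat \<Rightarrow> complex multiset" where
  "mat_spectrum M = proots (char_poly (map_mat complex_of_real M))"

text \<open>
  The choice of the enumeration is immaterial, see \<open>laplacian_spectrum_eq\<close> below.
\<close>

definition laplacian_spectrum :: "('a, 'b) pre_digraph \<Rightarrow> complex multiset" where
  "laplacian_spectrum G =
     mat_spectrum (laplacian_matrix G (SOME vs. distinct vs \<and> set vs = verts G))"

lemma laplacian_matrix_index:
  assumes "distinct vs" "i < length vs" "j < length vs"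
  shows "laplacian_matrix G vs $$ (i, j) =
    (if vs ! i = vs ! j then real (out_degree G (vs ! i)) else 0) -
    (if vs ! i \<rightarrow>\<^bsub>G\<^esub> vs ! j then 1 else 0)"
  using assms by (simp add: laplacian_matrix_def adjacency_matrix_def degree_matrix_def
      nth_eq_iff_index_eq)

lemma mat_spectrum_enumeration:
  assumes us: "distinct us" and vs: "distinct vs" and eq: "set us = set vs"
  shows "mat_spectrum (laplacian_matrix G us) = mat_spectrum (laplacian_matrix G vs)"
proof -
  define n where "n = length us"
  have n: "length us = n" "length vs = n"
    using us vs eq by (auto simp: n_def dest!: distinct_card)
  have "mset us = mset vs"
    using us vs eq by (simp add: set_eq_iff_mset_eq_distinct)
  then obtain p where p: "p permutes {..<length vs}" and uv: "permute_list p vs = us"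
    by (rule mset_eq_permutation)
  have pn: "p i < n" if "i < n" for i
    using permutes_in_image[OF p, of i] that n by simp
  have unth: "us ! i = vs ! p i" if "i < n" for i
    using uv permute_list_nth[OF p, of i] that n by simp
  define A where "A = map_mat complex_of_real (laplacian_matrix G us)"
  define B where "B = map_mat complex_of_real (laplacian_matrix G vs)"
  define P :: "complex mat" where "P = mat n n (\<lambda>(i, j). if j = p i then 1 else 0)"
  define Q :: "complex mat" where "Q = mat n n (\<lambda>(i, j). if i = p j then 1 else 0)"
  have A: "A \<in> carrier_mat n n" and B: "B \<in> carrier_mat n n"
    by (simp_all add: A_def B_def laplacian_matrix_def adjacency_matrix_def n minus_carrier_mat)
  have P: "P \<in> carrier_mat n n" and Q: "Q \<in> carrier_mat n n"
    by (simp_all add: P_def Q_def)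
  have inj: "p i = p j \<longleftrightarrow> i = j" for i j
    using permutes_inj[OF p] by (auto dest: injD)
  have PQ: "P * Q = 1\<^sub>m n"
    by (rule eq_matI) (auto simp: P_def Q_def scalar_prod_def inj pn
        if_distrib[of "\<lambda>x. _ * x"] sum.delta cong: if_cong)
  have QP: "Q * P = 1\<^sub>m n"
    by (rule mat_mult_left_right_inverse[OF P Q PQ])
  have PB: "P * B = mat n n (\<lambda>(i, j). B $$ (p i, j))"
    using B by (intro eq_matI)
      (auto simp: P_def scalar_prod_def if_distrib[of "\<lambda>x. x * _"] pn sum.delta cong: if_cong)
  have "P * B * Q = mat n n (\<lambda>(i, j). B $$ (p i, p j))"
    unfolding PB by (intro eq_matI)
      (auto simp: Q_def scalar_prod_def if_distrib[of "\<lambda>x. _ * x"] pn sum.delta cong: if_cong)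
  also have "\<dots> = A"
    using A B us vs by (intro eq_matI)
      (auto simp: A_def B_def laplacian_matrix_index n pn unth)
  finally have "A = P * B * Q" ..
  then have "similar_mat A B"
    using A B P Q PQ QP by (intro similar_matI[of A B P Q n]) auto
  from char_poly_similar[OF this] show ?thesis
    by (simp add: mat_spectrum_def A_def B_def)
qed

lemma laplacian_spectrum_eq:
  assumes "distinct vs" "set vs = verts G"
  shows "laplacian_spectrum G = mat_spectrum (laplacian_matrix G vs)"
proof -
  have "distinct (SOME vs. distinct vs \<and> set vs = verts G) \<and>
      set (SOME vs. distinct vs \<and> set vs = verts G) = verts G"
    by (rule someI[of _ vs]) (use assms in simp)
  with assms show ?thesis
    unfolding laplacian_spectrum_def by (intro mat_spectrum_enumeration) auto
qed

section \<open>Paths and centipedes\<close>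

definition path_graph :: "nat \<Rightarrow> nat pair_pre_digraph" where
  "path_graph k = \<lparr> pverts = {..<k},
     parcs = {(i, j). i < k \<and> j < k \<and> (j = Suc i \<or> i = Suc j)} \<rparr>"

text \<open>The pendant vertex appended at \<open>Inl v\<close>, for \<open>v \<in> S\<close>, is \<open>Inr v\<close>.\<close>

definition append_pendants :: "'a pair_pre_digraph \<Rightarrow> 'a set \<Rightarrow> ('a + 'a) pair_pre_digraph" where
  "append_pendants G S = \<lparr> pverts = Inl ` pverts G \<union> Inr ` S,
     parcs = {(Inl u, Inl v) | u v. (u, v) \<in> parcs G} \<union>
       {(Inl v, Inr v) | v. v \<in> S} \<union> {(Inr v, Inl v) | v. v \<in> S} \<rparr>"

definition centipede :: "nat \<Rightarrow> (nat + nat) pair_pre_digraph" where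
  "centipede k = append_pendants (path_graph k)
     {v \<in> pverts (path_graph k). out_degree (path_graph k) v = 2}"

lemma degree_two_path_graph:
  "{v \<in> pverts (path_graph k). out_degree (path_graph k) v = 2} = {1..<k - 1}"
proof -
  have "out_degree (path_graph k) v = 2 \<longleftrightarrow> v \<in> {1..<k - 1}" if "v < k" for v
  proof -
    have "out_arcs (path_graph k) v =
        (if Suc v < k then {(v, Suc v)} else {}) \<union> (if 0 < v then {(v, v - 1)} else {})"
      using that by (auto simp: out_arcs_def path_graph_def)
    then show ?thesis
      by (auto simp: out_degree_def)
  qed
  then show ?thesis
    by (auto simp: path_graph_def)
qed

lemma pair_graph_centipede: "pair_graph (centipede k)"
proof -
  let ?C = "centipede k"
  have arcs: "parcs ?C \<subseteq> pverts ?C \<times> pverts ?C"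
    by (auto simp: centipede_def append_pendants_def path_graph_def)
  have fin: "finite (pverts ?C)"
    by (simp add: centipede_def append_pendants_def path_graph_def)
  show ?thesis
  proof unfold_locales
    show "finite (parcs ?C)"
      using arcs fin by (meson finite_SigmaI finite_subset)
    show "symmetric (with_proj ?C)"
      by (auto simp: symmetric_def sym_def centipede_def append_pendants_def path_graph_def)
  qed (use arcs fin in \<open>auto simp: centipede_def append_pendants_def path_graph_def\<close>)
qed

lemma card_centipede:
  assumes "k \<ge> 2"
  shows "card (pverts (centipede k)) = 2 * k - 2"
proof -
  have "card (pverts (centipede k)) = card (Inl ` {..<k} \<union> Inr ` {1..<k - 1} :: (nat + nat) set)"
    unfolding centipede_def degree_two_path_graph
    by (simp add: append_pendants_def path_graph_def)
  also have "\<dots> = k + (k - 2)"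
    by (subst card_Un_disjoint) (auto simp: card_image)
  finally show ?thesis
    using assms by simp
qed

end

theory Submission
  imports
    Defs
    "Jordan_Normal_Form.Jordan_Normal_Form_Existence"
    "Jordan_Normal_Form.Jordan_Normal_Form_Uniqueness"
begin

text \<open>
  Laplacians are Hermitian, so cospectral ones are similar: the power traces agree, and so do the
  dimensions of all eigenspaces. The eigenvalue \<open>0\<close> is simple for the centipede, hence \<open>G\<close> is connected;
  by the trace it has \<open>n - 1\<close> edges, so it is a tree and has no triangles. The traces of the second
  and third powers then give \<open>\<Sum>(d - 1)(d - 2)(d - 3) = 0\<close> and \<open>\<Sum>(d - 1)(d - 3) = 0\<close> over the degrees of \<open>G\<close>,
  which forces all degrees to be \<open>1\<close> or \<open>3\<close>.

  The vertices of degree \<open>3\<close> induce a tree on \<open>k - 2\<close> vertices. Each of them that supports two leaves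
  contributes an independent eigenfunction for the eigenvalue \<open>1\<close>, whose multiplicity in the centipede is at
  most \<open>2\<close>. So this inner tree has at most two leaves; it is a path, and \<open>G\<close> is the centipede.
\<close>

section \<open>Cospectral Hermitian matrices are similar\<close>

text \<open>Diagonalizability turns equality of characteristic roots into similarity, so that
  multiplicities become dimensions of eigenspaces and can be compared through explicit functions on
  the vertices. The vertex count and the traces of three powers give only four moments of the degree
  sequence, and the last trace is disturbed by triangles; this is why the tree structure has to be
  settled before the cubes are used. The two polynomials are chosen to vanish at the degrees of the
  centipede and to have a constant sign, the cubic on the positive integers and the quadratic on {1,
  2, 3}. Degrees 1 and 3 still admit many trees. The eigenvalue 1 separates them: two leaves on a
  common support produce an eigenfunction whatever the rest of the tree looks like, while on the
  centipede the equation at a pendant vertex kills its support, so that an eigenfunction is fixed by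
  its values at the two ends of the path.\<close>

definition hermitian_mat :: "nat \<Rightarrow> complex mat \<Rightarrow> bool" where
  "hermitian_mat n A \<longleftrightarrow> A \<in> carrier_mat n n \<and>
     (\<forall>i<n. \<forall>j<n. A $$ (j, i) = cnj (A $$ (i, j)))"

lemma hermitian_mat_carrier: "hermitian_mat n A \<Longrightarrow> A \<in> carrier_mat n n"
  by (simp add: hermitian_mat_def)

lemma hermitian_mat_cscalar_prod:
  assumes A: "hermitian_mat n A" and v: "v \<in> carrier_vec n" and w: "w \<in> carrier_vec n"
  shows "(A *\<^sub>v v) \<bullet>c w = v \<bullet>c (A *\<^sub>v w)"
proof -
  have car: "A \<in> carrier_mat n n"
    and sym: "\<And>i j. i < n \<Longrightarrow> j < n \<Longrightarrow> A $$ (j, i) = cnj (A $$ (i, j))"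
    using A unfolding hermitian_mat_def by blast+
  have "(A *\<^sub>v v) \<bullet>c w = (\<Sum>i<n. \<Sum>j<n. A $$ (i, j) * v $ j * cnj (w $ i))"
    using car v w by (auto simp: scalar_prod_def sum_distrib_right atLeast0LessThan)
  also have "\<dots> = (\<Sum>j<n. \<Sum>i<n. A $$ (i, j) * v $ j * cnj (w $ i))"
    by (rule sum.swap)
  also have "\<dots> = (\<Sum>j<n. \<Sum>i<n. v $ j * cnj (A $$ (j, i) * w $ i))"
  proof (intro sum.cong refl)
    fix i j assume "j \<in> {..<n}" "i \<in> {..<n}"
    then show "A $$ (i, j) * v $ j * cnj (w $ i) = v $ j * cnj (A $$ (j, i) * w $ i)"
      using sym[of j i] by simp
  qed
  also have "\<dots> = v \<bullet>c (A *\<^sub>v w)"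
    using car v w by (auto simp: scalar_prod_def sum_distrib_left atLeast0LessThan)
  finally show ?thesis .
qed

lemma hermitian_mat_eigenvalue_real:
  assumes A: "hermitian_mat n A" and "eigenvalue A a"
  shows "cnj a = a"
proof -
  obtain v where v: "v \<in> carrier_vec n" "v \<noteq> 0\<^sub>v n" "A *\<^sub>v v = a \<cdot>\<^sub>v v"
    using assms(2) hermitian_mat_carrier[OF A] by (auto simp: eigenvalue_def eigenvector_def)
  have "a * (v \<bullet>c v) = (A *\<^sub>v v) \<bullet>c v"
    using v by simp
  also have "\<dots> = v \<bullet>c (A *\<^sub>v v)"
    using A v(1) v(1) by (rule hermitian_mat_cscalar_prod)
  also have "\<dots> = cnj a * (v \<bullet>c v)"
    using v by (simp add: conjugate_smult_vec)
  finally show ?thesis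
    using v by simp
qed

text \<open>If A A v = 0 then <A v, A v> = <A A v, v> = 0, so A v = 0. This excludes nontrivial
  Jordan blocks at the eigenvalue 0.\<close>

lemma hermitian_mat_kernel_square:
  assumes A: "hermitian_mat n A"
  shows "mat_kernel (A * A) = mat_kernel A"
proof
  have car: "A \<in> carrier_mat n n"
    using A by (rule hermitian_mat_carrier)
  show "mat_kernel A \<subseteq> mat_kernel (A * A)"
    using car car by (rule mat_kernel_mult_subset)
  show "mat_kernel (A * A) \<subseteq> mat_kernel A"
  proof
    fix v assume "v \<in> mat_kernel (A * A)"
    then have v: "v \<in> carrier_vec n" and "A * A *\<^sub>v v = 0\<^sub>v n"
      using mat_kernelD[OF mult_carrier_mat[OF car car]] by blast+
    then have AAv: "A *\<^sub>v (A *\<^sub>v v) = 0\<^sub>v n"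
      using assoc_mult_mat_vec[OF car car v] by metis
    have Av: "A *\<^sub>v v \<in> carrier_vec n"
      using car v by (rule mult_mat_vec_carrier)
    have "(A *\<^sub>v v) \<bullet>c (A *\<^sub>v v) = 0\<^sub>v n \<bullet>c v"
      using hermitian_mat_cscalar_prod[OF A Av v] unfolding AAv by (rule sym)
    also have "\<dots> = 0"
      using v by simp
    finally have "A *\<^sub>v v = 0\<^sub>v n"
      using conjugate_square_eq_0_vec[OF Av] by blast
    with car v show "v \<in> mat_kernel A"
      by (rule mat_kernelI)
  qed
qed

text \<open>For the block sizes of an eigenvalue \<open>a\<close> in a Jordan form, the two sums are
  the dimensions of the kernels of A - a and of its square. A block of size at least 2 adds more to
  the second.\<close>

lemma sum_list_min_one_two:
  assumes "(\<Sum>n\<leftarrow>ns. min (Suc 0) n) = (\<Sum>n\<leftarrow>ns. min 2 n)" "n \<in> set ns"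
  shows "n \<le> 1"
proof -
  have le: "(\<Sum>n\<leftarrow>ns. min (Suc 0) n) \<le> (\<Sum>n\<leftarrow>ns. min 2 n)" for ns :: "nat list"
    by (rule sum_list_mono) auto
  show ?thesis
    using assms
  proof (induction ns)
    case (Cons m ns)
    have "min (Suc 0) m = min 2 m \<and> (\<Sum>n\<leftarrow>ns. min (Suc 0) n) = (\<Sum>n\<leftarrow>ns. min 2 n)"
      using Cons.prems(1) le[of ns] by auto
    then show ?case
      using Cons by (auto simp: min_def split: if_splits)
  qed simp
qed

text \<open>A real shift keeps the diagonal real, so the kernel argument applies at every eigenvalue
  and not only at 0.\<close>

lemma hermitian_mat_char_matrix:
  assumes "hermitian_mat n A" "cnj a = a"
  shows "hermitian_mat n (char_matrix A a)"
  unfolding hermitian_mat_def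
proof (intro conjI allI impI)
  show "char_matrix A a \<in> carrier_mat n n"
    using assms(1) by (simp add: hermitian_mat_def)
  fix i j assume "i < n" "j < n"
  moreover from this have "A $$ (j, i) = cnj (A $$ (i, j))"
    using assms(1) unfolding hermitian_mat_def by blast
  ultimately show "char_matrix A a $$ (j, i) = cnj (char_matrix A a $$ (i, j))"
    using assms hermitian_mat_carrier[OF assms(1)] by (simp add: char_matrix_def)
qed

text \<open>The label \<open>a\<close> is a root of the characteristic polynomial, hence real, so A
  - a is Hermitian and has the same kernel as its square. That excludes blocks larger than 1; blocks
  of size 0 are excluded by the normal form itself.\<close>

lemma hermitian_mat_jordan_nf_blocks:
  assumes A: "hermitian_mat n A" and nf: "jordan_nf A n_as" and mem: "(m, a) \<in> set n_as"
  shows "m = 1"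
proof -
  have car: "A \<in> carrier_mat n n"
    using A by (rule hermitian_mat_carrier)
  have m0: "m \<noteq> 0"
    using nf mem by (force simp: jordan_nf_def)
  have "poly (char_poly A) a = 0"
    unfolding poly_eq_0_iff_dvd jordan_nf_char_poly[OF nf]
    by (rule dvd_trans[OF dvd_power[of m] prod_list_dvd[of "[:- a, 1:] ^ m"]])
      (use mem m0 in \<open>auto intro: image_eqI[of _ _ "(m, a)"]\<close>)
  then have "eigenvalue A a"
    by (simp add: eigenvalue_root_char_poly[OF car])
  then have h: "hermitian_mat n (char_matrix A a)"
    by (intro hermitian_mat_char_matrix A hermitian_mat_eigenvalue_real[OF A])
  let ?C = "char_matrix A a"
  have C: "?C \<in> carrier_mat n n"
    using car by simp
  have "kernel_dim (?C * ?C) = kernel_dim ?C"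
    using C by (simp add: kernel_dim_def hermitian_mat_kernel_square[OF h])
  then have "dim_gen_eigenspace A a 1 = dim_gen_eigenspace A a 2"
    using C by (simp add: dim_gen_eigenspace_def numeral_2_eq_2)
  then have "(\<Sum>n\<leftarrow>map fst [(n, e)\<leftarrow>n_as. e = a]. min (Suc 0) n) =
      (\<Sum>n\<leftarrow>map fst [(n, e)\<leftarrow>n_as. e = a]. min 2 n)"
    by (simp add: dim_gen_eigenspace[OF nf])
  moreover have "m \<in> set (map fst [(n, e)\<leftarrow>n_as. e = a])"
    using mem by (auto intro: image_eqI[of _ _ "(m, a)"])
  ultimately have "m \<le> 1"
    by (rule sum_list_min_one_two)
  with m0 show ?thesis by simp
qed

definition diag_mat_of :: "'a::zero list \<Rightarrow> 'a mat" where
  "diag_mat_of as = mat (length as) (length as) (\<lambda>(i, j). if i = j then as ! i else 0)"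

lemma jordan_matrix_size_one: "jordan_matrix (map (Pair 1) as) = diag_mat_of as"
proof (induction as)
  case Nil
  show ?case by (auto simp: jordan_matrix_def diag_mat_of_def)
next
  case (Cons a as)
  show ?case
    unfolding list.map(2) jordan_matrix_Cons Cons
    by (rule eq_matI) (auto simp: diag_mat_of_def nth_Cons sum_list_triv o_def split: nat.splits)
qed

lemma hermitian_mat_diagonalizable:
  assumes A: "hermitian_mat n A"
  obtains as where "similar_mat A (diag_mat_of as)" "mset as = proots (char_poly A)"
proof -
  have car: "A \<in> carrier_mat n n"
    using A by (rule hermitian_mat_carrier)
  obtain n_as where nf: "jordan_nf A n_as"
    using char_poly_factorized[OF car] jordan_nf_exists[OF car] by blast
  define as where "as = map snd n_as"
  have n_as: "n_as = map (Pair 1) as"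
    unfolding as_def map_map
    by (rule sym, rule map_idI) (use hermitian_mat_jordan_nf_blocks[OF A nf] in auto)
  have "similar_mat A (diag_mat_of as)"
    using nf by (simp add: jordan_nf_def n_as jordan_matrix_size_one del: One_nat_def)
  moreover have "proots (\<Prod>a\<leftarrow>xs. [:- a, 1:]) = mset xs" for xs :: "complex list"
  proof (induction xs)
    case (Cons x xs)
    have "(\<Prod>a\<leftarrow>xs. [:- a, 1:]) \<noteq> 0"
      by (auto simp: prod_list_zero_iff)
    then show ?case
      using Cons by (simp add: proots_mult del: mult_pCons_left)
  qed simp
  then have "mset as = proots (char_poly A)"
    unfolding jordan_nf_char_poly[OF nf] by (simp add: n_as o_def)
  ultimately show ?thesis
    by (rule that)
qed

lemma similar_diag_mat_of_permute:
  fixes as bs :: "'a::field list"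
  assumes "mset as = mset bs"
  shows "similar_mat (diag_mat_of as) (diag_mat_of bs)"
proof -
  define n where "n = length as"
  have n: "length as = n" "length bs = n"
    using mset_eq_length[OF assms] by (simp_all add: n_def)
  obtain p where p: "p permutes {..<length bs}" and ab: "permute_list p bs = as"
    using assms by (rule mset_eq_permutation)
  have pn: "p i < n" if "i < n" for i
    using permutes_in_image[OF p, of i] that n by simp
  have inj: "p i = p j \<longleftrightarrow> i = j" for i j
    using permutes_inj[OF p] by (auto dest: injD)
  have ath: "as ! i = bs ! p i" if "i < n" for i
    using ab permute_list_nth[OF p, of i] that n by simp
  \<comment> \<open>Row \<open>i\<close> of \<open>P\<close> is the unit vector at
    \<open>p i\<close>, and \<open>Q\<close> is the transpose of \<open>P\<close>; conjugation by
    them relabels both indices by \<open>p\<close>.\<close>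
  define P :: "'a mat" where "P = mat n n (\<lambda>(i, j). if j = p i then 1 else 0)"
  define Q :: "'a mat" where "Q = mat n n (\<lambda>(i, j). if i = p j then 1 else 0)"
  have P: "P \<in> carrier_mat n n" and Q: "Q \<in> carrier_mat n n"
    by (simp_all add: P_def Q_def)
  have PQ: "P * Q = 1\<^sub>m n"
    by (rule eq_matI) (auto simp: P_def Q_def scalar_prod_def inj pn
        if_distrib[of "\<lambda>x. _ * x"] sum.delta cong: if_cong)
  have QP: "Q * P = 1\<^sub>m n"
    by (rule mat_mult_left_right_inverse[OF P Q PQ])
  have B: "diag_mat_of bs \<in> carrier_mat n n" and A: "diag_mat_of as \<in> carrier_mat n n"
    by (simp_all add: diag_mat_of_def n)
  have PB: "P * diag_mat_of bs = mat n n (\<lambda>(i, j). diag_mat_of bs $$ (p i, j))"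
    using B by (intro eq_matI)
      (auto simp: P_def scalar_prod_def if_distrib[of "\<lambda>x. x * _"] pn sum.delta cong: if_cong)
  have "P * diag_mat_of bs * Q = mat n n (\<lambda>(i, j). diag_mat_of bs $$ (p i, p j))"
    unfolding PB by (intro eq_matI)
      (auto simp: Q_def scalar_prod_def if_distrib[of "\<lambda>x. _ * x"] pn sum.delta cong: if_cong)
  also have "\<dots> = diag_mat_of as"
    by (intro eq_matI) (auto simp: diag_mat_of_def n pn ath inj)
  finally show ?thesis
    using A B P Q PQ QP by (intro similar_matI[of _ _ P Q n]) auto
qed

lemma cospectral_hermitian_mat_similar:
  assumes "hermitian_mat n A" "hermitian_mat m B"
    and "proots (char_poly A) = proots (char_poly B)"
  shows "similar_mat A B"
proof -
  obtain as where as: "similar_mat A (diag_mat_of as)" "mset as = proots (char_poly A)"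
    using assms(1) by (rule hermitian_mat_diagonalizable)
  obtain bs where bs: "similar_mat B (diag_mat_of bs)" "mset bs = proots (char_poly B)"
    using assms(2) by (rule hermitian_mat_diagonalizable)
  have "similar_mat (diag_mat_of as) (diag_mat_of bs)"
    by (rule similar_diag_mat_of_permute) (simp add: as bs assms)
  then show ?thesis
    using as(1) bs(1) similar_mat_trans similar_mat_sym by blast
qed

section \<open>Invariants of similar matrices\<close>

text \<open>Gaussian elimination with unknowns \<open>c p\<close> and one equation for each element
  of \<open>S\<close>. Each induction step disposes of one equation, at the cost of one unknown if
  there is a pivot and of none otherwise.\<close>

lemma underdetermined_system_nontrivial_solution:
  fixes f :: "'p \<Rightarrow> 's \<Rightarrow> 'a::field"
  assumes "finite S" "finite I" "card S < card I"
  shows "\<exists>c. (\<exists>p\<in>I. c p \<noteq> 0) \<and> (\<forall>s\<in>S. (\<Sum>p\<in>I. c p * f p s) = 0)"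
  using assms
proof (induction S arbitrary: I f rule: finite_induct)
  case empty
  then obtain p where "p \<in> I"
    by fastforce
  then show ?case
    by (intro exI[of _ "\<lambda>_. 1"]) auto
next
  case (insert s S)
  show ?case
  proof (cases "\<forall>p\<in>I. f p s = 0")
    case True
    obtain c where "\<exists>p\<in>I. c p \<noteq> 0" "\<forall>t\<in>S. (\<Sum>p\<in>I. c p * f p t) = 0"
      using insert.IH[of I f] insert.prems insert.hyps by auto
    then show ?thesis
      using True by (auto intro!: exI[of _ c])
  next
    case False
    then obtain q where q: "q \<in> I" "f q s \<noteq> 0"
      by blast
    define J where "J = I - {q}"
    \<comment> \<open>The remaining equations after the unknown at the pivot \<open>q\<close> has
      been eliminated with equation \<open>s\<close>.\<close>
    define g where "g = (\<lambda>p t. f p t - f p s / f q s * f q t)"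
    have fin: "finite J" and I: "I = insert q J" and qJ: "q \<notin> J"
      using insert.prems q by (auto simp: J_def)
    have "card S < card J"
      using insert.prems insert.hyps fin qJ by (simp add: I)
    then obtain c where c: "\<exists>p\<in>J. c p \<noteq> 0" "\<forall>t\<in>S. (\<Sum>p\<in>J. c p * g p t) = 0"
      using insert.IH[of J g] fin by blast
    \<comment> \<open>Back substitution: the value at \<open>q\<close> is solved from equation
      \<open>s\<close>.\<close>
    define e where "e = c(q := - (\<Sum>p\<in>J. c p * f p s) / f q s)"
    have sum_e: "(\<Sum>p\<in>I. e p * f p t) = e q * f q t + (\<Sum>p\<in>J. c p * f p t)" for t
      unfolding I using fin qJ by (auto simp: e_def intro!: sum.cong)
    have "(\<Sum>p\<in>I. e p * f p s) = 0"
      using q by (simp add: sum_e) (simp add: e_def)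
    moreover have "(\<Sum>p\<in>I. e p * f p t) = 0" if "t \<in> S" for t
    proof -
      have "(\<Sum>p\<in>J. c p * g p t) = (\<Sum>p\<in>J. c p * f p t) - (\<Sum>p\<in>J. c p * f p s) / f q s * f q t"
        by (simp add: g_def sum_subtractf algebra_simps sum_distrib_left sum_divide_distrib)
      then show ?thesis
        using c(2) that by (simp add: sum_e) (simp add: e_def)
    qed
    moreover have "\<exists>p\<in>I. e p \<noteq> 0"
      using c(1) qJ unfolding I e_def by (metis fun_upd_apply insertCI)
    ultimately show ?thesis
      by (intro exI[of _ e]) auto
  qed
qed

lemma mult_mat_vec_linear_combination:
  fixes M :: "'a::comm_ring_1 mat"
  assumes M: "M \<in> carrier_mat n n" and u: "\<And>p. p \<in> I \<Longrightarrow> u p \<in> carrier_vec n"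
  shows "M *\<^sub>v vec n (\<lambda>i. \<Sum>p\<in>I. c p * u p $ i) = vec n (\<lambda>i. \<Sum>p\<in>I. c p * (M *\<^sub>v u p) $ i)"
proof (rule eq_vecI)
  fix i assume "i < dim_vec (vec n (\<lambda>i. \<Sum>p\<in>I. c p * (M *\<^sub>v u p) $ i))"
  then have i: "i < n" by simp
  have "(M *\<^sub>v vec n (\<lambda>i. \<Sum>p\<in>I. c p * u p $ i)) $ i =
      (\<Sum>j<n. \<Sum>p\<in>I. M $$ (i, j) * (c p * u p $ j))"
    using M i by (auto simp: scalar_prod_def sum_distrib_left atLeast0LessThan)
  also have "\<dots> = (\<Sum>p\<in>I. \<Sum>j<n. M $$ (i, j) * (c p * u p $ j))"
    by (rule sum.swap)
  also have "\<dots> = (\<Sum>p\<in>I. c p * (M *\<^sub>v u p) $ i)"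
  proof (rule sum.cong[OF refl])
    fix p assume "p \<in> I"
    then show "(\<Sum>j<n. M $$ (i, j) * (c p * u p $ j)) = c p * (M *\<^sub>v u p) $ i"
      using M i u[of p] by (auto simp: scalar_prod_def sum_distrib_left atLeast0LessThan ac_simps)
  qed
  finally show "(M *\<^sub>v vec n (\<lambda>i. \<Sum>p\<in>I. c p * u p $ i)) $ i =
      vec n (\<lambda>i. \<Sum>p\<in>I. c p * (M *\<^sub>v u p) $ i) $ i"
    using i by simp
qed (use M in simp)

text \<open>
  The eigenspaces of similar matrices are isomorphic; the family \<open>u\<close> bounds the dimension of the one
  of \<open>A\<close> from below and the coordinates in \<open>S\<close> bound that of \<open>B\<close> from above.
\<close>

lemma similar_mat_eigenspace_bound:
  fixes A B :: "'a::field mat"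
  assumes sim: "similar_mat A B" and A: "A \<in> carrier_mat n n"
    and fin: "finite I" "finite S"
    and u: "\<And>p. p \<in> I \<Longrightarrow> u p \<in> carrier_vec n"
    and eig: "\<And>p. p \<in> I \<Longrightarrow> A *\<^sub>v u p = x \<cdot>\<^sub>v u p"
    and indep: "\<And>c. (\<And>i. i < n \<Longrightarrow> (\<Sum>p\<in>I. c p * u p $ i) = 0) \<Longrightarrow> \<forall>p\<in>I. c p = 0"
    and S: "S \<subseteq> {..<n}"
    and det: "\<And>v. \<lbrakk>v \<in> carrier_vec n; B *\<^sub>v v = x \<cdot>\<^sub>v v; \<And>s. s \<in> S \<Longrightarrow> v $ s = 0\<rbrakk> \<Longrightarrow> v = 0\<^sub>v n"
  shows "card I \<le> card S"
proof (rule ccontr)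
  obtain P Q where wit: "similar_mat_wit A B P Q"
    using sim by (auto simp: similar_mat_def)
  note PQ = similar_mat_witD2[OF A wit]
  assume "\<not> card I \<le> card S"
  \<comment> \<open>There are more unknowns than coordinates in \<open>S\<close>, so a nontrivial
    combination of the images under \<open>Q\<close> vanishes on \<open>S\<close>.\<close>
  then obtain c where c: "\<exists>p\<in>I. c p \<noteq> 0" "\<forall>s\<in>S. (\<Sum>p\<in>I. c p * (Q *\<^sub>v u p) $ s) = 0"
    using underdetermined_system_nontrivial_solution[OF fin(2,1), of "\<lambda>p s. (Q *\<^sub>v u p) $ s"] by auto
  define v where "v = vec n (\<lambda>i. \<Sum>p\<in>I. c p * u p $ i)"
  have v: "v \<in> carrier_vec n"
    by (simp add: v_def)
  have Qv: "Q *\<^sub>v v = vec n (\<lambda>i. \<Sum>p\<in>I. c p * (Q *\<^sub>v u p) $ i)"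
    unfolding v_def using PQ(7) u by (rule mult_mat_vec_linear_combination)
  have Av: "A *\<^sub>v v = x \<cdot>\<^sub>v v"
  proof -
    have "(\<Sum>p\<in>I. c p * (A *\<^sub>v u p) $ i) = x * (\<Sum>p\<in>I. c p * u p $ i)" if "i < n" for i
      unfolding sum_distrib_left
    proof (rule sum.cong[OF refl])
      fix p assume "p \<in> I"
      then show "c p * (A *\<^sub>v u p) $ i = x * (c p * u p $ i)"
        using eig[of p] u[of p] that by simp
    qed
    then show ?thesis
      using mult_mat_vec_linear_combination[OF A u, of I "\<lambda>p. p" c] by (auto simp: v_def)
  qed
  \<comment> \<open>Since A = P B Q and Q P = 1, the matrix \<open>Q\<close> intertwines
    \<open>A\<close> with \<open>B\<close> and carries eigenvectors to eigenvectors.\<close>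
  have "Q * A = Q * P * (B * Q)"
    using PQ assoc_mult_mat[OF PQ(6,5,7)] assoc_mult_mat[OF PQ(7,6) mult_carrier_mat[OF PQ(5,7)]] by metis
  then have QA: "Q * A = B * Q"
    unfolding PQ(2) using left_mult_one_mat[OF mult_carrier_mat[OF PQ(5,7)]] by simp
  have "B *\<^sub>v (Q *\<^sub>v v) = Q *\<^sub>v (A *\<^sub>v v)"
    using QA assoc_mult_mat_vec[OF PQ(5,7) v] assoc_mult_mat_vec[OF PQ(7,4) v] by simp
  also have "\<dots> = x \<cdot>\<^sub>v (Q *\<^sub>v v)"
    unfolding Av using PQ(7) v by (rule mult_mat_vec)
  finally have BQv: "B *\<^sub>v (Q *\<^sub>v v) = x \<cdot>\<^sub>v (Q *\<^sub>v v)" .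
  have "(Q *\<^sub>v v) $ s = 0" if "s \<in> S" for s
  proof -
    have "s < n"
      using that S by blast
    then show ?thesis
      unfolding Qv using that c(2) by simp
  qed
  then have "Q *\<^sub>v v = 0\<^sub>v n"
    by (rule det[OF mult_mat_vec_carrier[OF PQ(7) v] BQv])
  then have "P * Q *\<^sub>v v = 0\<^sub>v n"
    using PQ(6) assoc_mult_mat_vec[OF PQ(6,7) v] by auto
  then have "v = 0\<^sub>v n"
    using v PQ(1) by simp
  then have "v $ i = 0" if "i < n" for i
    using that by simp
  then have "\<forall>p\<in>I. c p = 0"
    by (intro indep) (simp add: v_def)
  with c(1) show False
    by blast
qed

section \<open>Traces of powers of similar matrices\<close>

definition mat_trace :: "'a::comm_ring_1 mat \<Rightarrow> 'a" where
  "mat_trace A = (\<Sum>i<dim_row A. A $$ (i, i))"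

lemma mat_trace_mult_comm:
  assumes "A \<in> carrier_mat n n" "B \<in> carrier_mat n n"
  shows "mat_trace (A * B) = mat_trace (B * A)"
proof -
  have "mat_trace (A * B) = (\<Sum>i<n. \<Sum>j<n. A $$ (i, j) * B $$ (j, i))"
    using assms by (auto simp: mat_trace_def scalar_prod_def atLeast0LessThan)
  also have "\<dots> = (\<Sum>j<n. \<Sum>i<n. A $$ (i, j) * B $$ (j, i))"
    by (rule sum.swap)
  also have "\<dots> = mat_trace (B * A)"
    using assms by (auto simp: mat_trace_def scalar_prod_def atLeast0LessThan mult.commute)
  finally show ?thesis .
qed

lemma mat_trace_similar:
  assumes "similar_mat A B"
  shows "mat_trace A = mat_trace B"
proof -
  obtain n P Q where PQ: "{A, B, P, Q} \<subseteq> carrier_mat n n" "Q * P = 1\<^sub>m n" "A = P * B * Q"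
    using similar_matD[OF assms] by blast
  have "mat_trace A = mat_trace (Q * (P * B))"
    unfolding PQ(3) using PQ(1) by (intro mat_trace_mult_comm) auto
  also have "Q * (P * B) = Q * P * B"
    using PQ(1) by (simp add: assoc_mult_mat[of _ n n _ n _ n])
  also have "\<dots> = B"
    using PQ(1) unfolding PQ(2) by (intro left_mult_one_mat[of B n n]) auto
  finally show ?thesis .
qed

lemma mat_trace_pow_similar:
  assumes "similar_mat A B"
  shows "mat_trace (A ^\<^sub>m k) = mat_trace (B ^\<^sub>m k)"
proof -
  obtain P Q where "similar_mat_wit A B P Q"
    using assms by (auto simp: similar_mat_def)
  from similar_mat_wit_pow[OF this] have "similar_mat (A ^\<^sub>m k) (B ^\<^sub>m k)"
    unfolding similar_mat_def by (intro exI)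
  then show ?thesis
    by (rule mat_trace_similar)
qed

section \<open>The Laplacian as an operator on functions\<close>

definition neighbours :: "('a, 'b) pre_digraph \<Rightarrow> 'a \<Rightarrow> 'a set" where
  "neighbours G v = {u. v \<rightarrow>\<^bsub>G\<^esub> u}"

context graph
begin

lemma neighbours_subset_verts: "neighbours G v \<subseteq> verts G"
  by (auto simp: neighbours_def)

lemma finite_neighbours [simp]: "finite (neighbours G v)"
  by (rule finite_subset[OF neighbours_subset_verts]) simp

lemma neighbours_sym: "u \<in> neighbours G v \<longleftrightarrow> v \<in> neighbours G u"
  using graph_symmetric by (auto simp: neighbours_def)

lemma not_self_neighbour [simp]: "v \<notin> neighbours G v"
  using adj_not_same by (auto simp: neighbours_def)

lemma out_degree_eq_card_neighbours: "out_degree G v = card (neighbours G v)"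
proof -
  have "inj_on (head G) (out_arcs G v)"
    using no_multi_arcs by (auto simp: inj_on_def arc_to_ends_def)
  moreover have "head G ` out_arcs G v = neighbours G v"
    by (auto simp: neighbours_def arcs_ends_def arc_to_ends_def image_iff)
  ultimately show ?thesis
    by (metis card_image out_degree_def)
qed

lemma sum_degree: "(\<Sum>v\<in>verts G. card (neighbours G v)) = card (arcs G)"
proof -
  have "card (arcs G) = card (\<Union>v\<in>verts G. out_arcs G v)"
    by (rule arg_cong[of _ _ card]) auto
  also have "\<dots> = (\<Sum>v\<in>verts G. out_degree G v)"
    unfolding out_degree_def by (rule card_UN_disjoint) auto
  finally show ?thesis
    by (simp add: out_degree_eq_card_neighbours)
qed

end

text \<open>The product (D - A) f without an enumeration of the vertices, so that eigenfunctions can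
  be built and evaluated vertex by vertex.\<close>

definition lap :: "('a, 'b) pre_digraph \<Rightarrow> ('a \<Rightarrow> complex) \<Rightarrow> 'a \<Rightarrow> complex" where
  "lap G f v = of_nat (card (neighbours G v)) * f v - (\<Sum>u\<in>neighbours G v. f u)"

abbreviation cmat_laplacian :: "('a, 'b) pre_digraph \<Rightarrow> 'a list \<Rightarrow> complex mat" where
  "cmat_laplacian G vs \<equiv> map_mat complex_of_real (laplacian_matrix G vs)"

definition lap_entry :: "('a, 'b) pre_digraph \<Rightarrow> 'a \<Rightarrow> 'a \<Rightarrow> complex" where
  "lap_entry G u v = (if u = v then of_nat (card (neighbours G u)) else 0) -
     (if v \<in> neighbours G u then 1 else 0)"

context graph
begin

lemma lap_entry_sym: "lap_entry G u v = lap_entry G v u"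
  by (auto simp: lap_entry_def neighbours_sym[of u v])

lemma sum_lap_entry:
  assumes v: "v \<in> verts G"
  shows "(\<Sum>u\<in>verts G. lap_entry G v u * f u) = lap G f v"
proof -
  have "(\<Sum>u\<in>verts G. lap_entry G v u * f u) =
      (\<Sum>u\<in>verts G. if u = v then of_nat (card (neighbours G v)) * f u else 0) -
      (\<Sum>u\<in>verts G. if u \<in> neighbours G v then f u else 0)"
    unfolding sum_subtractf[symmetric] by (intro sum.cong) (auto simp: lap_entry_def algebra_simps)
  also have "\<dots> = lap G f v"
    using v neighbours_subset_verts[of v]
    by (simp add: lap_def sum.If_cases Int_absorb1)
  finally show ?thesis .
qed

context
  fixes vs assumes vs: "distinct vs" "set vs = verts G"
begin

lemma cmat_laplacian_carrier: "cmat_laplacian G vs \<in> carrier_mat (length vs) (length vs)"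
  by (simp add: laplacian_matrix_def adjacency_matrix_def minus_carrier_mat)

lemma cmat_laplacian_index:
  assumes "i < length vs" "j < length vs"
  shows "cmat_laplacian G vs $$ (i, j) = lap_entry G (vs ! i) (vs ! j)"
  using assms cmat_laplacian_carrier vs
  by (auto simp: laplacian_matrix_index lap_entry_def out_degree_eq_card_neighbours neighbours_def)

lemma hermitian_cmat_laplacian: "hermitian_mat (length vs) (cmat_laplacian G vs)"
  unfolding hermitian_mat_def
proof (intro conjI cmat_laplacian_carrier allI impI)
  fix i j assume "i < length vs" "j < length vs"
  then show "cmat_laplacian G vs $$ (j, i) = cnj (cmat_laplacian G vs $$ (i, j))"
    by (simp only: cmat_laplacian_index lap_entry_sym[of "vs ! j" "vs ! i"]) (simp add: lap_entry_def)
qed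

lemma sum_vertex_list: "(\<Sum>i<length vs. g (vs ! i)) = (\<Sum>v\<in>verts G. g v)"
  using sum.reindex_bij_betw[OF bij_betw_nth[OF vs(1) refl vs(2)[symmetric]], of g] by simp

lemma cmat_laplacian_mult_vec:
  assumes "i < length vs"
  shows "(cmat_laplacian G vs *\<^sub>v vec (length vs) (\<lambda>i. f (vs ! i))) $ i = lap G f (vs ! i)"
proof -
  have "(cmat_laplacian G vs *\<^sub>v vec (length vs) (\<lambda>i. f (vs ! i))) $ i =
      (\<Sum>j<length vs. cmat_laplacian G vs $$ (i, j) * f (vs ! j))"
    using assms cmat_laplacian_carrier by (auto simp: scalar_prod_def atLeast0LessThan)
  also have "\<dots> = (\<Sum>j<length vs. lap_entry G (vs ! i) (vs ! j) * f (vs ! j))"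
    using assms by (intro sum.cong) (auto simp only: cmat_laplacian_index lessThan_iff)
  also have "\<dots> = lap G f (vs ! i)"
    using sum_vertex_list[of "\<lambda>u. lap_entry G (vs ! i) u * f u"] sum_lap_entry[of "vs ! i" f]
      assms vs(2) nth_mem by fastforce
  finally show ?thesis .
qed

text \<open>Each trace is a weighted count of closed walks, with stationary steps allowed, whose
  length is the exponent.\<close>

lemma trace_laplacian:
  shows "mat_trace (cmat_laplacian G vs ^\<^sub>m 1) = (\<Sum>u\<in>verts G. lap_entry G u u)" (is ?T1)
    and "mat_trace (cmat_laplacian G vs ^\<^sub>m 2) =
      (\<Sum>u\<in>verts G. \<Sum>v\<in>verts G. lap_entry G u v * lap_entry G v u)" (is ?T2)
    and "mat_trace (cmat_laplacian G vs ^\<^sub>m 3) =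
      (\<Sum>u\<in>verts G. \<Sum>v\<in>verts G. \<Sum>w\<in>verts G. lap_entry G u v * lap_entry G v w * lap_entry G w u)"
      (is ?T3)
proof -
  let ?L = "cmat_laplacian G vs" and ?n = "length vs" and ?l = "lap_entry G"
  note C = cmat_laplacian_carrier
  have dim: "dim_row ?L = ?n" "dim_col ?L = ?n"
    using C by auto
  have i2: "(?L * ?L) $$ (i, k) = (\<Sum>v\<in>verts G. ?l (vs ! i) v * ?l v (vs ! k))"
    if "i < ?n" "k < ?n" for i k
  proof -
    have "(?L * ?L) $$ (i, k) = (\<Sum>j<?n. ?L $$ (i, j) * ?L $$ (j, k))"
      using that dim by (simp add: scalar_prod_def atLeast0LessThan)
    also have "\<dots> = (\<Sum>j<?n. ?l (vs ! i) (vs ! j) * ?l (vs ! j) (vs ! k))"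
      using that by (intro sum.cong) (auto simp only: cmat_laplacian_index lessThan_iff)
    finally show ?thesis
      by (simp only: sum_vertex_list[of "\<lambda>v. ?l (vs ! i) v * ?l v (vs ! k)"])
  qed
  have i3: "(?L * ?L * ?L) $$ (i, i) = (\<Sum>v\<in>verts G. \<Sum>w\<in>verts G. ?l (vs ! i) v * ?l v w * ?l w (vs ! i))"
    if "i < ?n" for i
  proof -
    have "(?L * ?L * ?L) $$ (i, i) = (\<Sum>j<?n. (?L * ?L) $$ (i, j) * ?L $$ (j, i))"
      using that dim by (simp add: scalar_prod_def atLeast0LessThan)
    also have "\<dots> = (\<Sum>j<?n. (\<Sum>v\<in>verts G. ?l (vs ! i) v * ?l v (vs ! j)) * ?l (vs ! j) (vs ! i))"
      using that by (intro sum.cong) (auto simp only: cmat_laplacian_index i2 lessThan_iff)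
    also have "\<dots> = (\<Sum>w\<in>verts G. \<Sum>v\<in>verts G. ?l (vs ! i) v * ?l v w * ?l w (vs ! i))"
      by (simp only: sum_distrib_right
          sum_vertex_list[of "\<lambda>w. \<Sum>v\<in>verts G. ?l (vs ! i) v * ?l v w * ?l w (vs ! i)"])
    also have "\<dots> = (\<Sum>v\<in>verts G. \<Sum>w\<in>verts G. ?l (vs ! i) v * ?l v w * ?l w (vs ! i))"
      by (rule sum.swap)
    finally show ?thesis .
  qed
  have pow: "?L ^\<^sub>m 1 = ?L" "?L ^\<^sub>m 2 = ?L * ?L" "?L ^\<^sub>m 3 = ?L * ?L * ?L"
    using C dim by (simp_all add: numeral_eq_Suc)
  have "mat_trace ?L = (\<Sum>i<?n. ?l (vs ! i) (vs ! i))"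
    unfolding mat_trace_def dim by (intro sum.cong) (auto simp only: cmat_laplacian_index lessThan_iff)
  then show ?T1
    unfolding pow by (simp only: sum_vertex_list[of "\<lambda>u. ?l u u"])
  have "mat_trace (?L * ?L) = (\<Sum>i<?n. \<Sum>v\<in>verts G. ?l (vs ! i) v * ?l v (vs ! i))"
    unfolding mat_trace_def index_mult_mat dim by (intro sum.cong) (auto simp only: i2 lessThan_iff)
  then show ?T2
    unfolding pow by (simp only: sum_vertex_list[of "\<lambda>u. \<Sum>v\<in>verts G. ?l u v * ?l v u"])
  have "mat_trace (?L * ?L * ?L) =
      (\<Sum>i<?n. \<Sum>v\<in>verts G. \<Sum>w\<in>verts G. ?l (vs ! i) v * ?l v w * ?l w (vs ! i))"
    unfolding mat_trace_def index_mult_mat dim by (intro sum.cong) (auto simp only: i3 lessThan_iff)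
  then show ?T3
    unfolding pow
    by (simp only: sum_vertex_list[of "\<lambda>u. \<Sum>v\<in>verts G. \<Sum>w\<in>verts G. ?l u v * ?l v w * ?l w u"])
qed

end

lemma card_neighbours_sum:
  "(\<Sum>v\<in>verts G. if v \<in> neighbours G u then c else 0) = of_nat (card (neighbours G u)) * (c::complex)"
  using neighbours_subset_verts[of u] by (simp add: sum.If_cases Int_absorb1)

lemma sum_lap_entry_diag:
  "(\<Sum>u\<in>verts G. lap_entry G u u) = of_nat (\<Sum>v\<in>verts G. card (neighbours G v))"
  by (simp add: lap_entry_def)

lemma sum_lap_entry_square:
  "(\<Sum>u\<in>verts G. \<Sum>v\<in>verts G. lap_entry G u v * lap_entry G v u) =
     of_nat (\<Sum>v\<in>verts G. card (neighbours G v) ^ 2 + card (neighbours G v))"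
proof -
  have "(\<Sum>v\<in>verts G. lap_entry G u v * lap_entry G v u) =
      of_nat (card (neighbours G u) ^ 2 + card (neighbours G u))" if "u \<in> verts G" for u
  proof -
    \<comment> \<open>No vertex is its own neighbour, so the diagonal and adjacency parts never meet
      and the minus sign squares away.\<close>
    have "lap_entry G u v * lap_entry G v u =
        (if v = u then of_nat (card (neighbours G u) ^ 2) else 0) + (if v \<in> neighbours G u then 1 else 0)" for v
      using neighbours_sym[of u v] by (auto simp: lap_entry_def power2_eq_square)
    then show ?thesis
      using that by (simp add: sum.distrib card_neighbours_sum)
  qed
  then show ?thesis
    by simp
qed

text \<open>For L = D - A, tr L^3 = tr D^3 - 3 tr D^2 A + 3 tr D A^2 - tr A^3. The second term
  vanishes without loops, the last one counts triangles, and tr D A^2 is the sum of the squared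
  degrees.\<close>

lemma sum_lap_entry_cube:
  assumes triangle_free: "\<And>u v w. \<lbrakk>v \<in> neighbours G u; w \<in> neighbours G v; u \<in> neighbours G w\<rbrakk> \<Longrightarrow> False"
  shows "(\<Sum>u\<in>verts G. \<Sum>v\<in>verts G. \<Sum>w\<in>verts G. lap_entry G u v * lap_entry G v w * lap_entry G w u) =
     of_nat (\<Sum>v\<in>verts G. card (neighbours G v) ^ 3 + 3 * card (neighbours G v) ^ 2)"
proof -
  define d where "d = (\<lambda>v. of_nat (card (neighbours G v)) :: complex)"
  define a where "a = (\<lambda>u v. if v \<in> neighbours G u then 1 else 0 :: complex)"
  have sum_a: "(\<Sum>v\<in>verts G. a u v) = d u" for u
    using card_neighbours_sum[of u 1] by (simp add: a_def d_def)
  have inner: "(\<Sum>v\<in>verts G. \<Sum>w\<in>verts G. lap_entry G u v * lap_entry G v w * lap_entry G w u) =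
      d u ^ 3 + 2 * d u ^ 2 + (\<Sum>v\<in>verts G. d v * a u v)" if u: "u \<in> verts G" for u
  proof -
    \<comment> \<open>The surviving closed walks u, v, w, u: all three steps stationary, or exactly
      one of them, namely the first, second or third.\<close>
    have entry: "lap_entry G u v * lap_entry G v w * lap_entry G w u =
        (if v = u then if w = u then d u ^ 3 else 0 else 0) + (if v = u then d u * a u w else 0) +
        (if w = v then d v * a u v else 0) + (if w = u then d u * a u v else 0)" for v w
    proof -
      have "\<not> (v \<in> neighbours G u \<and> w \<in> neighbours G v \<and> u \<in> neighbours G w)"
        using triangle_free by blast
      then show ?thesis
        using neighbours_sym[of u v] neighbours_sym[of v w] neighbours_sym[of w u]
        by (auto simp: lap_entry_def a_def d_def power3_eq_cube split: if_splits)
    qed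
    have "(\<Sum>v\<in>verts G. \<Sum>w\<in>verts G. if v = u then if w = u then d u ^ 3 else 0 else 0) = d u ^ 3"
      by (subst sum.swap) (simp add: u)
    moreover have "(\<Sum>v\<in>verts G. \<Sum>w\<in>verts G. if v = u then d u * a u w else 0) = d u * d u"
      by (subst sum.swap) (simp add: u sum_a flip: sum_distrib_left)
    moreover have "(\<Sum>v\<in>verts G. \<Sum>w\<in>verts G. if w = v then d v * a u v else 0) =
        (\<Sum>v\<in>verts G. d v * a u v)"
      by simp
    moreover have "(\<Sum>v\<in>verts G. \<Sum>w\<in>verts G. if w = u then d u * a u v else 0) = d u * d u"
      by (simp add: u sum_a flip: sum_distrib_left)
    ultimately show ?thesis
      by (simp add: entry sum.distrib power2_eq_square)
  qed
  \<comment> \<open>Summing the degrees of all neighbours over all vertices counts each degree once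
    per neighbour, which squares it.\<close>
  have "(\<Sum>u\<in>verts G. \<Sum>v\<in>verts G. d v * a u v) = (\<Sum>v\<in>verts G. \<Sum>u\<in>verts G. d v * a v u)"
    by (subst sum.swap) (simp add: a_def neighbours_sym)
  also have "\<dots> = (\<Sum>v\<in>verts G. d v ^ 2)"
    by (simp add: sum_a power2_eq_square flip: sum_distrib_left)
  finally show ?thesis
    by (simp add: inner sum.distrib sum_distrib_left[symmetric]) (simp add: d_def)
qed

end

section \<open>Cospectral graphs\<close>

lemma graph_vertex_list:
  assumes "graph G"
  obtains vs where "distinct vs" "set vs = verts G"
proof -
  interpret graph G by fact
  show ?thesis
    using finite_distinct_list[OF finite_verts] that by blast
qed

locale cospectral_graphs = G: graph G + H: graph H
  for G :: "('a, 'b) pre_digraph" and H :: "('c, 'd) pre_digraph" +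
  assumes cospectral: "laplacian_spectrum G = laplacian_spectrum H"
begin

lemma laplacian_similar:
  assumes us: "distinct us" "set us = verts G" and vs: "distinct vs" "set vs = verts H"
  shows "similar_mat (cmat_laplacian G us) (cmat_laplacian H vs)"
  using G.hermitian_cmat_laplacian[OF us] H.hermitian_cmat_laplacian[OF vs]
  by (rule cospectral_hermitian_mat_similar)
    (use cospectral laplacian_spectrum_eq[OF us] laplacian_spectrum_eq[OF vs] in \<open>simp add: mat_spectrum_def\<close>)

lemma length_vertex_lists:
  assumes us: "distinct us" "set us = verts G" and vs: "distinct vs" "set vs = verts H"
  shows "length us = length vs"
proof -
  obtain n where "{cmat_laplacian G us, cmat_laplacian H vs} \<subseteq> carrier_mat n n"
    using similar_matD[OF laplacian_similar[OF assms]] by blast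
  then show ?thesis
    using G.cmat_laplacian_carrier[OF us] H.cmat_laplacian_carrier[OF vs]
    by (metis carrier_matD(1) insert_subset)
qed

lemma card_verts_eq: "card (verts G) = card (verts H)"
  by (metis G.graph_axioms H.graph_axioms distinct_card graph_vertex_list length_vertex_lists)

lemma sum_degree_eq:
  "(\<Sum>v\<in>verts G. card (neighbours G v)) = (\<Sum>v\<in>verts H. card (neighbours H v))" (is "?a = ?b")
  and sum_degree_square_eq:
  "(\<Sum>v\<in>verts G. card (neighbours G v) ^ 2 + card (neighbours G v)) =
   (\<Sum>v\<in>verts H. card (neighbours H v) ^ 2 + card (neighbours H v))" (is "?c = ?d")
  and sum_degree_cube_eq:
  "\<lbrakk>\<And>u v w. \<lbrakk>v \<in> neighbours G u; w \<in> neighbours G v; u \<in> neighbours G w\<rbrakk> \<Longrightarrow> False;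
    \<And>u v w. \<lbrakk>v \<in> neighbours H u; w \<in> neighbours H v; u \<in> neighbours H w\<rbrakk> \<Longrightarrow> False\<rbrakk> \<Longrightarrow>
   (\<Sum>v\<in>verts G. card (neighbours G v) ^ 3 + 3 * card (neighbours G v) ^ 2) =
   (\<Sum>v\<in>verts H. card (neighbours H v) ^ 3 + 3 * card (neighbours H v) ^ 2)"
    (is "\<lbrakk>PROP ?A; PROP ?B\<rbrakk> \<Longrightarrow> ?e = ?f")
proof -
  obtain us where us: "distinct us" "set us = verts G"
    using graph_vertex_list[OF G.graph_axioms] .
  obtain vs where vs: "distinct vs" "set vs = verts H"
    using graph_vertex_list[OF H.graph_axioms] .
  note tr = mat_trace_pow_similar[OF laplacian_similar[OF us vs]]
  have "complex_of_nat ?a = of_nat ?b"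
    using tr[of 1] unfolding G.trace_laplacian(1)[OF us] H.trace_laplacian(1)[OF vs]
      G.sum_lap_entry_diag H.sum_lap_entry_diag .
  then show "?a = ?b"
    by (simp only: of_nat_eq_iff)
  have "complex_of_nat ?c = of_nat ?d"
    using tr[of 2] unfolding G.trace_laplacian(2)[OF us] H.trace_laplacian(2)[OF vs]
      G.sum_lap_entry_square H.sum_lap_entry_square .
  then show "?c = ?d"
    by (simp only: of_nat_eq_iff)
  assume A: "PROP ?A" and B: "PROP ?B"
  have "complex_of_nat ?e = mat_trace (cmat_laplacian G us ^\<^sub>m 3)"
    unfolding G.trace_laplacian(3)[OF us] by (rule G.sum_lap_entry_cube[symmetric]) (rule A)
  also have "\<dots> = mat_trace (cmat_laplacian H vs ^\<^sub>m 3)"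
    by (rule tr)
  also have "\<dots> = of_nat ?f"
    unfolding H.trace_laplacian(3)[OF vs] by (rule H.sum_lap_entry_cube) (rule B)
  finally have "complex_of_nat ?e = of_nat ?f" .
  then show "?e = ?f"
    by (simp only: of_nat_eq_iff)
qed

text \<open>Comparison of eigenspaces in terms of functions. On the \<open>H\<close> side no
  dimension is computed: it is capped by a set \<open>S\<close> such that an eigenfunction vanishing
  on \<open>S\<close> vanishes everywhere. It is applied to the eigenvalue 0 with one vertex and to
  the eigenvalue 1 with two.\<close>

lemma eigenfunction_bound:
  assumes fin: "finite I"
    and eig: "\<And>p v. \<lbrakk>p \<in> I; v \<in> verts G\<rbrakk> \<Longrightarrow> lap G (u p) v = x * u p v"
    and indep: "\<And>c. (\<And>v. v \<in> verts G \<Longrightarrow> (\<Sum>p\<in>I. c p * u p v) = 0) \<Longrightarrow> \<forall>p\<in>I. c p = 0"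
    and S: "S \<subseteq> verts H"
    and det: "\<And>f v. \<lbrakk>\<And>v. v \<in> verts H \<Longrightarrow> lap H f v = x * f v; \<And>s. s \<in> S \<Longrightarrow> f s = 0; v \<in> verts H\<rbrakk>
      \<Longrightarrow> f v = 0"
  shows "card I \<le> card S"
proof -
  obtain us where us: "distinct us" "set us = verts G"
    using graph_vertex_list[OF G.graph_axioms] .
  obtain vs where vs: "distinct vs" "set vs = verts H"
    using graph_vertex_list[OF H.graph_axioms] .
  define n where "n = length us"
  have n: "length us = n" "length vs = n"
    using length_vertex_lists[OF us vs] by (simp_all add: n_def)
  have bij: "bij_betw ((!) vs) {..<n} (verts H)"
    using bij_betw_nth[OF vs(1) refl vs(2)[symmetric]] n by simp
  define S' where "S' = {i. i < n \<and> vs ! i \<in> S}"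
  have "(!) vs ` S' = S"
    using S bij unfolding S'_def bij_betw_def by auto
  moreover have "inj_on ((!) vs) S'"
    using bij by (auto simp: S'_def bij_betw_def intro: inj_on_subset)
  ultimately have cardS: "card S' = card S"
    by (metis card_image)
  have "card I \<le> card S'"
  proof (rule similar_mat_eigenspace_bound[OF laplacian_similar[OF us vs]
        G.cmat_laplacian_carrier[OF us, unfolded n] fin, where u = "\<lambda>p. vec n (\<lambda>i. u p (us ! i))" and x = x])
    show "finite S'" "S' \<subseteq> {..<n}"
      by (auto simp: S'_def)
    fix p assume p: "p \<in> I"
    show "cmat_laplacian G us *\<^sub>v vec n (\<lambda>i. u p (us ! i)) = x \<cdot>\<^sub>v vec n (\<lambda>i. u p (us ! i))"
    proof (rule eq_vecI)
      fix i assume "i < dim_vec (x \<cdot>\<^sub>v vec n (\<lambda>i. u p (us ! i)))"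
      then have i: "i < n" by simp
      then have "us ! i \<in> verts G"
        using us n nth_mem by fastforce
      then show "(cmat_laplacian G us *\<^sub>v vec n (\<lambda>i. u p (us ! i))) $ i = (x \<cdot>\<^sub>v vec n (\<lambda>i. u p (us ! i))) $ i"
        using G.cmat_laplacian_mult_vec[OF us, of i "u p"] i n eig[OF p] by simp
    qed (use G.cmat_laplacian_carrier[OF us] n in auto)
  next
    fix c assume c: "\<And>i. i < n \<Longrightarrow> (\<Sum>p\<in>I. c p * vec n (\<lambda>i. u p (us ! i)) $ i) = 0"
    show "\<forall>p\<in>I. c p = 0"
    proof (rule indep)
      fix v assume "v \<in> verts G"
      then obtain i where "i < n" "v = us ! i"
        using us n by (metis in_set_conv_nth)
      then show "(\<Sum>p\<in>I. c p * u p v) = 0"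
        using c[of i] by simp
    qed
  next
    fix w assume w: "w \<in> carrier_vec n" and ev: "cmat_laplacian H vs *\<^sub>v w = x \<cdot>\<^sub>v w"
      and zero: "\<And>s. s \<in> S' \<Longrightarrow> w $ s = 0"
    \<comment> \<open>The coordinate vector read back as a function on the vertices of
      \<open>H\<close>.\<close>
    define f where "f = (\<lambda>v. w $ the_inv_into {..<n} ((!) vs) v)"
    have f: "f (vs ! i) = w $ i" if "i < n" for i
      using that bij by (simp add: f_def bij_betw_def the_inv_into_f_f)
    then have wf: "w = vec n (\<lambda>i. f (vs ! i))"
      using w by auto
    have "f v = 0" if "v \<in> verts H" for v
      using _ _ that
    proof (rule det)
      fix v assume "v \<in> verts H"
      then obtain i where i: "i < n" "v = vs ! i"
        using vs n by (metis in_set_conv_nth)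
      have "lap H f v = (cmat_laplacian H vs *\<^sub>v w) $ i"
        using H.cmat_laplacian_mult_vec[OF vs, of i f] i n wf by simp
      then show "lap H f v = x * f v"
        using ev w i f by simp
    next
      fix s assume "s \<in> S"
      then obtain i where i: "i \<in> S'" "s = vs ! i"
        using \<open>(!) vs ` S' = S\<close> by blast
      then show "f s = 0"
        using zero[OF i(1)] f[of i] by (simp add: S'_def)
    qed
    then have "f (vs ! i) = 0" if "i < n" for i
      using that vs(2) n nth_mem by metis
    then show "w = 0\<^sub>v n"
      using f w by (intro eq_vecI) auto
  qed auto
  with cardS show ?thesis
    by simp
qed

end

text \<open>
  Connectedness, phrased by closed vertex sets because these are what harmonic functions detect.
\<close>

definition indecomposable :: "('a, 'b) pre_digraph \<Rightarrow> bool" where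
  "indecomposable G \<longleftrightarrow>
     (\<forall>S \<subseteq> verts G. S \<noteq> {} \<longrightarrow> (\<forall>v\<in>S. neighbours G v \<subseteq> S) \<longrightarrow> S = verts G)"

lemma indecomposableD:
  assumes "indecomposable G" "S \<subseteq> verts G" "v \<in> S" "\<And>v. v \<in> S \<Longrightarrow> neighbours G v \<subseteq> S"
  shows "S = verts G"
  using assms unfolding indecomposable_def by blast

text \<open>By symmetry of adjacency no edge joins \<open>S\<close> to its complement, so the
  indicator is constant on each vertex together with its neighbours.\<close>

lemma (in graph) lap_indicator:
  assumes "\<And>v. v \<in> S \<Longrightarrow> neighbours G v \<subseteq> S"
  shows "lap G (\<lambda>u. if u \<in> S then 1 else 0) v = 0"
proof (cases "v \<in> S")
  case True
  then have "(\<Sum>u\<in>neighbours G v. if u \<in> S then 1 else 0) = (\<Sum>u\<in>neighbours G v. 1 :: complex)"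
    using assms by (intro sum.cong) auto
  with True show ?thesis
    by (simp add: lap_def)
next
  case False
  then have "(\<Sum>u\<in>neighbours G v. if u \<in> S then 1 else 0) = (\<Sum>u\<in>neighbours G v. 0 :: complex)"
    using assms neighbours_sym by (intro sum.cong) auto
  with False show ?thesis
    by (simp add: lap_def)
qed

text \<open>A proper closed set and its complement have two independent harmonic indicators, one
  more than \<open>H\<close> allows when a harmonic function is determined by its value at
  \<open>s\<close>.\<close>

lemma (in cospectral_graphs) indecomposable_if_harmonic_constant:
  assumes s: "s \<in> verts H"
    and det: "\<And>f v. \<lbrakk>\<And>v. v \<in> verts H \<Longrightarrow> lap H f v = 0; f s = 0; v \<in> verts H\<rbrakk> \<Longrightarrow> f v = 0"
  shows "indecomposable G"
  unfolding indecomposable_def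
proof (intro allI impI, rule ccontr)
  fix S assume S: "S \<subseteq> verts G" "S \<noteq> {}" "\<forall>v\<in>S. neighbours G v \<subseteq> S" and ne: "S \<noteq> verts G"
  define T where "T = (\<lambda>b. if b then S else verts G - S)"
  have T: "neighbours G v \<subseteq> T b" if "v \<in> T b" for v b
    using that S(3) G.neighbours_sym G.neighbours_subset_verts
    by (auto simp: T_def split: if_splits) (metis subsetD)+
  obtain a b where ab: "a \<in> S" "b \<in> verts G" "b \<notin> S"
    using S ne by blast
  have "card (UNIV :: bool set) \<le> card {s}"
  proof (rule eigenfunction_bound[where u = "\<lambda>b v. if v \<in> T b then 1 else 0" and x = 0])
    show "lap G (\<lambda>v. if v \<in> T b then 1 else 0) v = 0 * (if v \<in> T b then 1 else 0)" for b v
      using G.lap_indicator[OF T] by simp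
    fix c :: "bool \<Rightarrow> complex"
    assume c: "\<And>v. v \<in> verts G \<Longrightarrow> (\<Sum>b\<in>UNIV. c b * (if v \<in> T b then 1 else 0)) = 0"
    show "\<forall>b\<in>UNIV. c b = 0"
      using c[of a] c[of b] ab S(1) by (auto simp: UNIV_bool T_def all_bool_eq)
  qed (use s det in auto)
  then show False
    by simp
qed

section \<open>Trees and degrees\<close>

text \<open>
  Here \<open>f\<close> is the distance from a root and \<open>p\<close> picks a neighbour one step closer to it. The links
  \<open>v \<mapsto> p v\<close> already account for all the arcs, by counting.
\<close>

lemma (in graph) arcs_are_parent_links:
  assumes conn: "indecomposable G" and ne: "verts G \<noteq> {}"
    and arcs: "(\<Sum>v\<in>verts G. card (neighbours G v)) = 2 * (card (verts G) - 1)"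
  obtains f :: "'a \<Rightarrow> nat" and p :: "'a \<Rightarrow> 'a"
    where "\<And>u v. v \<in> neighbours G u \<Longrightarrow> (v = p u \<and> f v < f u) \<or> (u = p v \<and> f u < f v)"
proof -
  obtain r where r: "r \<in> verts G"
    using ne by blast
  define D where "D = (\<lambda>v. {n. (r, v) \<in> arcs_ends G ^^ n})"
  define f where "f = (\<lambda>v. LEAST n. n \<in> D v)"
  have "{v \<in> verts G. D v \<noteq> {}} = verts G"
  proof (rule indecomposableD[OF conn, of _ r])
    have "(0::nat) \<in> D r"
      by (simp add: D_def)
    then show "r \<in> {v \<in> verts G. D v \<noteq> {}}"
      using r by blast
    fix v assume "v \<in> {v \<in> verts G. D v \<noteq> {}}"
    then obtain n where n: "(r, v) \<in> arcs_ends G ^^ n"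
      by (auto simp: D_def)
    have "Suc n \<in> D u" if "u \<in> neighbours G v" for u
      using n that by (auto simp: D_def neighbours_def)
    then show "neighbours G v \<subseteq> {v \<in> verts G. D v \<noteq> {}}"
      using neighbours_subset_verts by blast
  qed auto
  then have D: "D v \<noteq> {}" if "v \<in> verts G" for v
    using that by blast
  have "\<forall>v\<in>verts G - {r}. \<exists>u. u \<in> neighbours G v \<and> f u < f v"
  proof
    fix v assume v: "v \<in> verts G - {r}"
    have fv: "f v \<in> D v"
      unfolding f_def by (rule LeastI_ex) (use D v in blast)
    then obtain m where m: "f v = Suc m"
      using v by (cases "f v") (auto simp: D_def)
    \<comment> \<open>The last vertex before \<open>v\<close> on a shortest walk from the
      root.\<close>
    then obtain u where u: "(r, u) \<in> arcs_ends G ^^ m" "(u, v) \<in> arcs_ends G"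
      using fv by (auto simp: D_def)
    have "f u \<le> m"
      unfolding f_def by (rule Least_le) (use u in \<open>simp add: D_def\<close>)
    moreover have "u \<in> neighbours G v"
      using u(2) neighbours_sym[of u v] by (simp add: neighbours_def)
    ultimately show "\<exists>u. u \<in> neighbours G v \<and> f u < f v"
      using m by (intro exI[of _ u]) simp
  qed
  then obtain p where p: "\<And>v. v \<in> verts G - {r} \<Longrightarrow> p v \<in> neighbours G v \<and> f (p v) < f v"
    by metis
  \<comment> \<open>Parent links in both directions. As \<open>f\<close> drops along
    \<open>p\<close>, the two sets are disjoint; with n - 1 links each, n being the number of
    vertices, they exhaust the 2 (n - 1) pairs in \<open>E\<close>.\<close>
  define up where "up = (\<lambda>v. (v, p v)) ` (verts G - {r})"
  define down where "down = (\<lambda>v. (p v, v)) ` (verts G - {r})"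
  define E where "E = (SIGMA v:verts G. neighbours G v)"
  have finE: "finite E" and cardE: "card E = 2 * (card (verts G) - 1)"
    using arcs by (auto simp: E_def)
  have p': "v \<in> neighbours G (p v)" "p v \<in> verts G" if "v \<in> verts G - {r}" for v
    using p[OF that] neighbours_sym[of v "p v"] neighbours_subset_verts[of v] by blast+
  have "up \<union> down \<subseteq> E"
    using p p' by (auto simp: E_def up_def down_def)
  moreover have "up \<inter> down = {}"
  proof (rule equals0I)
    fix e assume "e \<in> up \<inter> down"
    then obtain v w where vw: "v \<in> verts G - {r}" "e = (v, p v)" "w \<in> verts G - {r}" "e = (p w, w)"
      unfolding up_def down_def by (elim IntE imageE)
    from vw(2,4) have "p v = w" "p w = v"
      by (metis prod.inject)+
    with p[OF vw(1)] p[OF vw(3)] show False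
      by (metis less_asym)
  qed
  moreover have "card up = card (verts G) - 1" "card down = card (verts G) - 1"
    using r by (auto simp: up_def down_def card_image inj_on_def)
  moreover have "finite up" "finite down"
    by (auto simp: up_def down_def)
  ultimately have "up \<union> down = E"
    using finE cardE by (intro card_subset_eq) (auto simp: card_Un_disjoint)
  show ?thesis
  proof
    fix u v assume uv: "v \<in> neighbours G u"
    then have "u \<in> verts G"
      using neighbours_sym[of u v] neighbours_subset_verts[of v] by blast
    with uv have "(u, v) \<in> up \<union> down"
      unfolding \<open>up \<union> down = E\<close> by (simp add: E_def)
    then show "(v = p u \<and> f v < f u) \<or> (u = p v \<and> f u < f v)"
      using p by (auto simp: up_def down_def)
  qed
qed

text \<open>Adjacent vertices have different depths, so one vertex of a triangle is strictly
  deepest. Both others would then be its parent, hence equal, although they are adjacent.\<close>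

lemma (in graph) triangle_free_if_tree:
  assumes "indecomposable G" "verts G \<noteq> {}"
    and "(\<Sum>v\<in>verts G. card (neighbours G v)) = 2 * (card (verts G) - 1)"
    and tri: "v \<in> neighbours G u" "w \<in> neighbours G v" "u \<in> neighbours G w"
  shows False
proof (rule arcs_are_parent_links[OF assms(1-3)])
  fix f :: "'a \<Rightarrow> nat" and p :: "'a \<Rightarrow> 'a"
  assume fp: "\<And>u v. v \<in> neighbours G u \<Longrightarrow> (v = p u \<and> f v < f u) \<or> (u = p v \<and> f u < f v)"
  show False
    using fp[OF tri(1)] fp[OF tri(2)] fp[OF tri(3)] by (metis less_asym less_trans)
qed

text \<open>The sums of \<open>t\<close> and \<open>q\<close> over the degrees are combinations of
  the vertex count and the first three power sums, so they agree with those of \<open>H\<close>,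
  where every term is 0. The absence of isolated vertices matters because \<open>t\<close> is
  negative at 0.\<close>

lemma (in cospectral_graphs) degrees_one_or_three:
  assumes H: "\<And>v. v \<in> verts H \<Longrightarrow> card (neighbours H v) \<in> {1, 3}"
    and trH: "\<And>u v w. \<lbrakk>v \<in> neighbours H u; w \<in> neighbours H v; u \<in> neighbours H w\<rbrakk> \<Longrightarrow> False"
    and trG: "\<And>u v w. \<lbrakk>v \<in> neighbours G u; w \<in> neighbours G v; u \<in> neighbours G w\<rbrakk> \<Longrightarrow> False"
    and pos: "\<And>v. v \<in> verts G \<Longrightarrow> neighbours G v \<noteq> {}"
    and v: "v \<in> verts G"
  shows "card (neighbours G v) \<in> {1, 3}"
proof -
  define dG where "dG = (\<lambda>v. int (card (neighbours G v)))"
  define dH where "dH = (\<lambda>v. int (card (neighbours H v)))"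
  have s1: "sum dG (verts G) = sum dH (verts H)"
    using arg_cong[OF sum_degree_eq, of int] by (simp add: dG_def dH_def)
  have s2: "(\<Sum>v\<in>verts G. dG v ^ 2) = (\<Sum>v\<in>verts H. dH v ^ 2)"
    using arg_cong[OF sum_degree_square_eq, of int] s1 by (simp add: dG_def dH_def sum.distrib)
  have "(\<Sum>v\<in>verts G. card (neighbours G v) ^ 3 + 3 * card (neighbours G v) ^ 2) =
      (\<Sum>v\<in>verts H. card (neighbours H v) ^ 3 + 3 * card (neighbours H v) ^ 2)"
    by (rule sum_degree_cube_eq) (erule (2) trG trH)+
  from arg_cong[OF this, of int] have s3: "(\<Sum>v\<in>verts G. dG v ^ 3) = (\<Sum>v\<in>verts H. dH v ^ 3)"
    using s2 by (simp add: dG_def dH_def sum.distrib flip: sum_distrib_left)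
  define q where "q = (\<lambda>d::int. (d - 1) * (d - 3))"
  define t where "t = (\<lambda>d::int. (d - 1) * (d - 2) * (d - 3))"
  have q: "q d = d ^ 2 - 4 * d + 3" and t: "t d = d ^ 3 - 6 * d ^ 2 + 11 * d - 6" for d
    by (simp_all add: q_def t_def algebra_simps power2_eq_square power3_eq_cube)
  have qH: "q (dH v) = 0" and tH: "t (dH v) = 0" if "v \<in> verts H" for v
    using H[OF that] by (auto simp: q_def t_def dH_def)
  have "(\<Sum>v\<in>verts G. t (dG v)) = (\<Sum>v\<in>verts H. t (dH v))"
    using s1 s2 s3 card_verts_eq by (simp add: t sum.distrib sum_subtractf flip: sum_distrib_left)
  then have sumt: "(\<Sum>v\<in>verts G. t (dG v)) = 0"
    using tH by simp
  have d1: "dG v \<ge> 1" if "v \<in> verts G" for v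
    using pos[OF that] by (auto simp: dG_def Suc_le_eq card_gt_0_iff)
  \<comment> \<open>All factors are nonnegative from 3 on, and the integers 1 and 2 below are
    roots.\<close>
  have "t d \<ge> 0" if "d \<ge> 1" for d
  proof (cases "d \<ge> 3")
    case False
    with that have "d = 1 \<or> d = 2" by auto
    then show ?thesis by (auto simp: t_def)
  qed (simp add: t_def)
  then have "t (dG v) = 0" if "v \<in> verts G" for v
    using sum_nonneg_eq_0_iff[of "verts G" "\<lambda>v. t (dG v)"] sumt d1 that by auto
  then have d123: "dG v \<in> {1, 2, 3}" if "v \<in> verts G" for v
    using that by (auto simp: t_def)
  have "(\<Sum>v\<in>verts G. q (dG v)) = (\<Sum>v\<in>verts H. q (dH v))"
    using s1 s2 card_verts_eq by (simp add: q sum.distrib sum_subtractf flip: sum_distrib_left)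
  then have "(\<Sum>v\<in>verts G. - q (dG v)) = 0"
    using qH by (simp add: sum_negf)
  \<comment> \<open>Among 1, 2, 3 only the value at 2 is nonzero, and it is 1; a vanishing sum
    therefore leaves no vertex of degree 2.\<close>
  moreover have "- q (dG v) \<ge> 0" if "v \<in> verts G" for v
    using d123[OF that] by (auto simp: q_def)
  ultimately have "q (dG v) = 0"
    using v sum_nonneg_eq_0_iff[of "verts G" "\<lambda>v. - q (dG v)"] by auto
  then show ?thesis
    by (auto simp: q_def dG_def)
qed

section \<open>Paths and centipedes\<close>

text \<open>A longest path from the endpoint \<open>w\<close> is closed under neighbours, hence
  covers \<open>I\<close>: its interior vertices have no neighbour to spare, and maximality confines
  the neighbours of its last vertex. A bare neighbourhood function is used because the lemma is
  applied to an adjacency restricted to part of a graph.\<close>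

lemma path_enumeration:
  fixes nb :: "'a \<Rightarrow> 'a set"
  assumes fin: "finite I" "\<And>v. finite (nb v)"
    and sym: "\<And>u v. u \<in> nb v \<Longrightarrow> v \<in> nb u" and irrefl: "\<And>v. v \<notin> nb v"
    and sub: "\<And>v. v \<in> I \<Longrightarrow> nb v \<subseteq> I"
    and deg: "\<And>v. v \<in> I \<Longrightarrow> card (nb v) \<le> 2"
    and w: "w \<in> I" "card (nb w) \<le> 1"
    and conn: "\<And>S. \<lbrakk>S \<subseteq> I; S \<noteq> {}; \<And>v. v \<in> S \<Longrightarrow> nb v \<subseteq> S\<rbrakk> \<Longrightarrow> S = I"
  obtains xs where "distinct xs" "set xs = I"
    "\<And>i. Suc i < length xs \<Longrightarrow> xs ! Suc i \<in> nb (xs ! i)"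
    "\<And>i y. \<lbrakk>i < length xs; y \<in> nb (xs ! i)\<rbrakk> \<Longrightarrow>
       (Suc i < length xs \<and> y = xs ! Suc i) \<or> (0 < i \<and> y = xs ! (i - 1))"
proof -
  define path where "path = (\<lambda>xs. xs \<noteq> [] \<and> xs ! 0 = w \<and> distinct xs \<and> set xs \<subseteq> I \<and>
      (\<forall>i. Suc i < length xs \<longrightarrow> xs ! Suc i \<in> nb (xs ! i)))"
  have "path [w]"
    using w by (simp add: path_def)
  moreover have "\<forall>xs. path xs \<longrightarrow> length xs < Suc (card I)"
  proof (intro allI impI)
    fix xs assume "path xs"
    then show "length xs < Suc (card I)"
      using card_mono[OF fin(1), of "set xs"] by (simp add: path_def distinct_card)
  qed
  ultimately have "\<exists>xs. path xs \<and> (\<forall>ys. path ys \<longrightarrow> length ys \<le> length xs)"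
    by (rule ex_has_greatest_nat)
  then obtain xs where xs: "path xs" and max: "\<And>ys. path ys \<Longrightarrow> length ys \<le> length xs"
    by blast
  have ne: "xs \<noteq> []" and x0: "xs ! 0 = w" and dist: "distinct xs" and xsI: "set xs \<subseteq> I"
    and step: "\<And>i. Suc i < length xs \<Longrightarrow> xs ! Suc i \<in> nb (xs ! i)"
    using xs by (auto simp: path_def)
  have mem: "xs ! i \<in> I" if "i < length xs" for i
    using that xsI by (meson nth_mem subsetD)
  \<comment> \<open>The start has at most one neighbour, used by its successor; any later vertex has
    at most two, used by its successor and predecessor.\<close>
  have inner: "y = xs ! Suc i \<or> (0 < i \<and> y = xs ! (i - 1))"
    if i: "Suc i < length xs" and y: "y \<in> nb (xs ! i)" for i y
  proof (cases "i = 0")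
    case True
    have "card {y, xs ! Suc 0} \<le> card (nb w)"
      using y step[OF i] True x0 fin(2) by (intro card_mono) auto
    with w(2) have "card {y, xs ! Suc 0} \<le> 1"
      by (rule order_trans[rotated])
    then have "y = xs ! Suc 0"
      by (cases "y = xs ! Suc 0") simp_all
    then show ?thesis
      by (simp add: True)
  next
    case False
    have "xs ! (i - 1) \<in> nb (xs ! i)"
      by (rule sym) (use step[of "i - 1"] False i in simp)
    then have "card {y, xs ! Suc i, xs ! (i - 1)} \<le> card (nb (xs ! i))"
      using y step[OF i] fin(2) by (intro card_mono) auto
    also have "\<dots> \<le> 2"
      using i by (intro deg mem) simp
    finally have le: "card {y, xs ! Suc i, xs ! (i - 1)} \<le> 2" .
    have "xs ! Suc i \<noteq> xs ! (i - 1)"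
      using dist i by (simp add: nth_eq_iff_index_eq)
    with le have "y = xs ! Suc i \<or> y = xs ! (i - 1)"
      by (cases "y = xs ! Suc i"; cases "y = xs ! (i - 1)") simp_all
    then show ?thesis
      using False by blast
  qed
  \<comment> \<open>A neighbour off the path would prolong it. A neighbour on the path is not the
    last vertex, so \<open>inner\<close> applies to it and makes it the predecessor.\<close>
  have last: "0 < i \<and> y = xs ! (i - 1)"
    if i: "Suc i = length xs" and y: "y \<in> nb (xs ! i)" for i y
  proof -
    have "y \<in> set xs"
    proof (rule ccontr)
      assume "y \<notin> set xs"
      moreover have "y \<in> I"
        using y i sub[OF mem[of i]] by auto
      moreover have "(xs @ [y]) ! Suc j \<in> nb ((xs @ [y]) ! j)" if "Suc j < length (xs @ [y])" for j
        using that i y step[of j] by (cases "j = i") (auto simp: nth_append)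
      ultimately have "path (xs @ [y])"
        using ne x0 dist xsI by (auto simp: path_def nth_append)
      from max[OF this] show False
        by simp
    qed
    then obtain j where j: "j < length xs" "y = xs ! j"
      by (metis in_set_conv_nth)
    have "j \<noteq> i"
      using irrefl y j by metis
    then have sj: "Suc j < length xs"
      using j i by linarith
    have "xs ! i = xs ! Suc j \<or> (0 < j \<and> xs ! i = xs ! (j - 1))"
      using inner[OF sj, of "xs ! i"] sym[OF y] j by blast
    then have "i = Suc j"
      using dist i sj by (auto simp: nth_eq_iff_index_eq)
    then show ?thesis
      using j by simp
  qed
  have all: "(Suc i < length xs \<and> y = xs ! Suc i) \<or> (0 < i \<and> y = xs ! (i - 1))"
    if "i < length xs" "y \<in> nb (xs ! i)" for i y
    using inner[of i y] last[of i y] that by (cases "Suc i < length xs") auto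
  have "set xs = I"
  proof (rule conn[OF xsI])
    fix v assume "v \<in> set xs"
    then obtain i where i: "i < length xs" "v = xs ! i"
      by (metis in_set_conv_nth)
    show "nb v \<subseteq> set xs"
    proof
      fix y assume "y \<in> nb v"
      then show "y \<in> set xs"
        using all[OF i(1), of y] i by auto
    qed
  qed (use ne in simp)
  with dist show ?thesis
    using step all by (rule that)
qed

section \<open>The centipede: degrees, colouring and eigenfunctions for the eigenvalues 0 and
  1\<close>

context
  fixes k :: nat
  assumes k: "k \<ge> 2"
begin

lemma graph_centipede: "graph (with_proj (centipede k))"
  by (rule pair_graph.pair_graphD_graph[OF pair_graph_centipede])

lemma parcs_centipede:
  "parcs (centipede k) = {(Inl u, Inl v) | u v. u < k \<and> v < k \<and> (v = Suc u \<or> u = Suc v)} \<union>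
     {(Inl v, Inr v) | v. v \<in> {1..<k - 1}} \<union> {(Inr v, Inl v) | v. v \<in> {1..<k - 1}}"
  unfolding centipede_def degree_two_path_graph by (simp add: append_pendants_def path_graph_def)

lemma pverts_centipede: "pverts (centipede k) = Inl ` {..<k} \<union> Inr ` {1..<k - 1}"
  unfolding centipede_def degree_two_path_graph by (simp add: append_pendants_def path_graph_def)

lemma verts_centipede_cases:
  assumes "v \<in> pverts (centipede k)"
  obtains "v = Inl 0" | "v = Inl (k - 1)" | i where "1 \<le> i" "i < k - 1" "v = Inl i"
    | i where "1 \<le> i" "i < k - 1" "v = Inr i"
proof -
  have "i = 0 \<or> i = k - 1 \<or> 1 \<le> i \<and> i < k - 1" if "i < k" for i
    using that by linarith
  then show ?thesis
    using assms that by (auto simp: pverts_centipede)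
qed

lemma neighbours_centipede:
  "neighbours (with_proj (centipede k)) (Inl 0) = {Inl 1}"
  "neighbours (with_proj (centipede k)) (Inl (k - 1)) = {Inl (k - 2)}"
  "\<lbrakk>1 \<le> i; i < k - 1\<rbrakk> \<Longrightarrow>
     neighbours (with_proj (centipede k)) (Inl i) = {Inl (i - 1), Inl (Suc i), Inr i}"
  "\<lbrakk>1 \<le> i; i < k - 1\<rbrakk> \<Longrightarrow> neighbours (with_proj (centipede k)) (Inr i) = {Inl i}"
  using k by (auto simp: neighbours_def parcs_centipede)

lemma card_neighbours_centipede:
  "card (neighbours (with_proj (centipede k)) (Inl 0)) = 1"
  "card (neighbours (with_proj (centipede k)) (Inl (k - 1))) = 1"
  "\<lbrakk>1 \<le> i; i < k - 1\<rbrakk> \<Longrightarrow> card (neighbours (with_proj (centipede k)) (Inl i)) = 3"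
  "\<lbrakk>1 \<le> i; i < k - 1\<rbrakk> \<Longrightarrow> card (neighbours (with_proj (centipede k)) (Inr i)) = 1"
  by (simp_all add: neighbours_centipede del: One_nat_def)

lemma degrees_centipede:
  assumes "v \<in> pverts (centipede k)"
  shows "card (neighbours (with_proj (centipede k)) v) \<in> {1, 3}"
  using assms by (rule verts_centipede_cases) (simp_all add: card_neighbours_centipede del: One_nat_def)

lemma sum_degree_centipede:
  "(\<Sum>v\<in>pverts (centipede k). card (neighbours (with_proj (centipede k)) v)) = 4 * k - 6"
proof -
  let ?d = "\<lambda>v. card (neighbours (with_proj (centipede k)) v)"
  have "{..<k} = {0, k - 1} \<union> {1..<k - 1}"
    using k by auto
  then have "pverts (centipede k) = ({Inl 0, Inl (k - 1)} \<union> Inl ` {1..<k - 1}) \<union> Inr ` {1..<k - 1}"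
    by (simp add: pverts_centipede image_Un)
  moreover have "sum ?d (({Inl 0, Inl (k - 1)} \<union> Inl ` {1..<k - 1}) \<union> Inr ` {1..<k - 1}) =
      sum ?d {Inl 0, Inl (k - 1)} + sum ?d (Inl ` {1..<k - 1}) + sum ?d (Inr ` {1..<k - 1})"
    by (subst sum.union_disjoint; (subst sum.union_disjoint)?) auto
  moreover have "sum ?d {Inl 0, Inl (k - 1)} = 2"
    using k by (simp add: card_neighbours_centipede del: One_nat_def)
  moreover have "sum ?d (Inl ` {1..<k - 1}) = 3 * (k - 2)" "sum ?d (Inr ` {1..<k - 1}) = k - 2"
    by (simp_all add: sum.reindex card_neighbours_centipede del: One_nat_def)
  ultimately have "sum ?d (pverts (centipede k)) = 2 + 3 * (k - 2) + (k - 2)"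
    by (simp only:)
  also have "\<dots> = 4 * k - 6"
    using k by linarith
  finally show ?thesis .
qed

text \<open>Colour the path vertices by parity and each pendant vertex opposite to its support.\<close>

lemma triangle_free_centipede:
  assumes "v \<in> neighbours (with_proj (centipede k)) u" "w \<in> neighbours (with_proj (centipede k)) v"
    "u \<in> neighbours (with_proj (centipede k)) w"
  shows False
proof -
  have "case_sum even odd y \<longleftrightarrow> \<not> case_sum even odd x"
    if "y \<in> neighbours (with_proj (centipede k)) x" for x y
    using that by (auto simp: neighbours_def parcs_centipede)
  from this[OF assms(1)] this[OF assms(2)] this[OF assms(3)] show False
    by blast
qed

text \<open>A pendant vertex repeats the value of its support, so the equation at each path vertex
  yields the next value from two consecutive ones. Values propagate from
  \<open>Inl 0\<close>.\<close>

lemma harmonic_centipede: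
  assumes lap: "\<And>v. v \<in> pverts (centipede k) \<Longrightarrow> lap (with_proj (centipede k)) f v = 0"
    and f0: "f (Inl 0) = 0" and v: "v \<in> pverts (centipede k)"
  shows "f v = 0"
proof -
  have pendant: "f (Inr i) = f (Inl i)" if "1 \<le> i" "i < k - 1" for i
    using lap[of "Inr i"] that
    by (simp add: lap_def card_neighbours_centipede neighbours_centipede pverts_centipede del: One_nat_def)
  have "f (Inl i) = 0 \<and> (Suc i < k \<longrightarrow> f (Inl (Suc i)) = 0)" if "i < k" for i
    using that
  proof (induction i)
    case 0
    then show ?case
      using lap[of "Inl 0"] f0 by (simp add: lap_def neighbours_centipede pverts_centipede)
  next
    case (Suc i)
    then have IH: "f (Inl i) = 0" "f (Inl (Suc i)) = 0"
      by auto
    have "f (Inl (Suc (Suc i))) = 0" if "Suc (Suc i) < k"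
      using lap[of "Inl (Suc i)"] pendant[of "Suc i"] IH that
      by (simp add: lap_def neighbours_centipede pverts_centipede)
    with IH show ?case
      by blast
  qed
  then show ?thesis
    using v pendant by (auto simp: pverts_centipede)
qed

text \<open>The equation at a pendant vertex reads f(pendant) - f(support) = f(pendant), so supports
  vanish. With the two ends also zero, the equation at a support leaves only its pendant value,
  which must vanish.\<close>

lemma eigenvalue_one_centipede:
  assumes lap: "\<And>v. v \<in> pverts (centipede k) \<Longrightarrow> lap (with_proj (centipede k)) f v = 1 * f v"
    and ends: "f (Inl 0) = 0" "f (Inl (k - 1)) = 0" and v: "v \<in> pverts (centipede k)"
  shows "f v = 0"
proof -
  have inner: "f (Inl i) = 0" if "1 \<le> i" "i < k - 1" for i
    using lap[of "Inr i"] that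
    by (simp add: lap_def card_neighbours_centipede neighbours_centipede pverts_centipede del: One_nat_def)
  then have path: "f (Inl i) = 0" if "i < k" for i
    using that ends by (cases "i = 0 \<or> i = k - 1") auto
  have "f (Inr i) = 0" if "1 \<le> i" "i < k - 1" for i
    using lap[of "Inl i"] path[of "i - 1"] path[of i] path[of "Suc i"] that
    by (simp add: lap_def neighbours_centipede pverts_centipede)
  with path v show ?thesis
    by (auto simp: pverts_centipede)
qed

end

text \<open>An injective homomorphism between graphs with equally many vertices and equally many
  arcs is bijective on both. The isomorphism runs from \<open>G\<close>, so the inverse of the
  embedding is used.\<close>

lemma digraph_iso_from_embedding:
  assumes G: "graph G" and P: "graph (with_proj P)"
    and inj: "inj_on \<psi> (pverts P)" and img: "\<psi> ` pverts P \<subseteq> verts G"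
    and card: "card (verts G) = card (pverts P)"
    and hom: "\<And>u v. (u, v) \<in> parcs P \<Longrightarrow> \<psi> v \<in> neighbours G (\<psi> u)"
    and arcs: "(\<Sum>v\<in>verts G. card (neighbours G v)) = (\<Sum>v\<in>pverts P. card (neighbours (with_proj P) v))"
  shows "digraph_iso G (with_proj P)"
proof -
  interpret G: graph G by fact
  interpret P: graph "with_proj P" by fact
  have bij: "\<psi> ` pverts P = verts G"
    using card img by (intro card_subset_eq) (simp_all add: card_image[OF inj])
  define \<phi> where "\<phi> = the_inv_into (pverts P) \<psi>"
  have \<phi>: "\<phi> (\<psi> v) = v" if "v \<in> pverts P" for v
    using that inj by (simp add: \<phi>_def the_inv_into_f_f)
  have pairs: "u \<in> pverts P" "v \<in> pverts P" if "(u, v) \<in> parcs P" for u v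
    using P.wellformed[of "(u, v)"] that by auto
  have injE: "inj_on (arc_to_ends G) (arcs G)"
    using G.no_multi_arcs by (auto intro: inj_onI)
  have "map_prod \<psi> \<psi> ` parcs P \<subseteq> arcs_ends G"
    using hom by (auto simp: neighbours_def)
  moreover have "card (map_prod \<psi> \<psi> ` parcs P) = card (arcs_ends G)"
  proof -
    have "inj_on (map_prod \<psi> \<psi>) (parcs P)"
      using pairs inj by (auto simp: inj_on_def)
    then have "card (map_prod \<psi> \<psi> ` parcs P) = card (arcs G)"
      using G.sum_degree P.sum_degree arcs by (simp add: card_image)
    then show ?thesis
      by (simp add: arcs_ends_def card_image[OF injE])
  qed
  ultimately have ends: "map_prod \<psi> \<psi> ` parcs P = arcs_ends G"
    by (intro card_subset_eq) (simp_all add: arcs_ends_def)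
  \<comment> \<open>Arcs of \<open>G\<close> have an arbitrary type while those of \<open>P\<close>
    are pairs, so an arc is sent to the pair of images of its ends.\<close>
  define h where "h = \<lparr>iso_verts = \<phi>, iso_arcs = map_prod \<phi> \<phi> \<circ> arc_to_ends G,
      iso_head = snd, iso_tail = fst\<rparr>"
  have \<phi>inj: "inj_on \<phi> (verts G)"
    unfolding bij[symmetric] by (rule inj_onI) (auto simp: \<phi>)
  have "inj_on (map_prod \<phi> \<phi>) (arc_to_ends G ` arcs G)"
    using \<phi>inj by (auto simp: inj_on_def arc_to_ends_def)
  then have "inj_on (map_prod \<phi> \<phi> \<circ> arc_to_ends G) (arcs G)"
    by (rule comp_inj_on[OF injE])
  then have "G.digraph_isomorphism h"
    unfolding G.digraph_isomorphism_def h_def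
    using \<phi>inj G.wf_digraph by (auto simp: arc_to_ends_def)
  moreover have "map_prod \<phi> \<phi> ` arcs_ends G = parcs P"
  proof -
    have "map_prod \<phi> \<phi> (map_prod \<psi> \<psi> e) = e" if "e \<in> parcs P" for e
      using that pairs \<phi> by (cases e) auto
    then show ?thesis
      unfolding ends[symmetric] image_image by simp
  qed
  then have "with_proj P = app_iso h G"
    unfolding app_iso_def h_def with_proj_def
    using \<phi> by (auto simp: bij[symmetric] image_image image_comp[symmetric] arcs_ends_def)
  ultimately show ?thesis
    unfolding digraph_iso_def by blast
qed

section \<open>Trees with degrees one and three\<close>

text \<open>The bound \<open>k3\<close> sets aside the single edge, the case k = 2, where there is
  no vertex of degree 3 and the two leaves are adjacent.\<close>

locale one_three_tree = graph G for G :: "('a, 'b) pre_digraph" +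
  fixes k :: nat
  assumes k3: "k \<ge> 3" and conn: "indecomposable G"
    and deg: "\<And>v. v \<in> verts G \<Longrightarrow> card (neighbours G v) \<in> {1, 3}"
    and card_verts: "card (verts G) = 2 * k - 2"
    and sum_deg: "(\<Sum>v\<in>verts G. card (neighbours G v)) = 4 * k - 6"
begin

definition inner :: "'a set" where "inner = {v \<in> verts G. card (neighbours G v) = 3}"

definition leaves :: "'a set" where "leaves = {v \<in> verts G. card (neighbours G v) = 1}"

lemma verts_split: "verts G = inner \<union> leaves" "inner \<inter> leaves = {}"
  using deg by (auto simp: inner_def leaves_def)

lemma finite_inner [simp]: "finite inner" and finite_leaves [simp]: "finite leaves"
  by (simp_all add: inner_def leaves_def)

lemma inner_not_leaf: "v \<in> inner \<Longrightarrow> v \<notin> leaves"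
  using verts_split(2) by blast

text \<open>With i inner vertices and l leaves, the vertex count is i + l = 2 k - 2 and the degree
  sum is 3 i + l = 4 k - 6.\<close>

lemma card_inner: "card inner = k - 2" and card_leaves: "card leaves = k"
proof -
  have c: "card inner + card leaves = 2 * k - 2"
    using card_verts verts_split by (simp add: card_Un_disjoint)
  have "(\<Sum>v\<in>verts G. card (neighbours G v)) =
      (\<Sum>v\<in>inner. card (neighbours G v)) + (\<Sum>v\<in>leaves. card (neighbours G v))"
    unfolding verts_split(1) by (rule sum.union_disjoint) (simp_all add: verts_split(2))
  also have "(\<Sum>v\<in>inner. card (neighbours G v)) = (\<Sum>v\<in>inner. 3)"
    by (rule sum.cong) (simp_all add: inner_def)
  also have "(\<Sum>v\<in>leaves. card (neighbours G v)) = (\<Sum>v\<in>leaves. 1)"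
    by (rule sum.cong) (simp_all add: leaves_def)
  finally have "3 * card inner + card leaves = 4 * k - 6"
    using sum_deg by simp
  with c show "card inner = k - 2" "card leaves = k"
    using k3 by linarith+
qed

lemma leaf_neighbours_singleton: "v \<in> leaves \<Longrightarrow> \<exists>u. neighbours G v = {u}"
  by (simp add: leaves_def card_1_singleton_iff)

text \<open>Two adjacent leaves would form a closed set of two vertices, but \<open>G\<close> is
  connected with at least four.\<close>

lemma leaf_neighbour:
  assumes v: "v \<in> leaves" and u: "u \<in> neighbours G v"
  shows "neighbours G v = {u}" "u \<in> inner"
proof -
  obtain x where "neighbours G v = {x}"
    using leaf_neighbours_singleton[OF v] by blast
  with u show Nv: "neighbours G v = {u}"
    by simp
  have uV: "u \<in> verts G" and vV: "v \<in> verts G"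
    using u neighbours_subset_verts[of v] v by (auto simp: leaves_def)
  show "u \<in> inner"
  proof (rule ccontr)
    assume "u \<notin> inner"
    then have "u \<in> leaves"
      using uV verts_split(1) by blast
    moreover have "v \<in> neighbours G u"
      using u neighbours_sym[of u v] by blast
    ultimately have Nu: "neighbours G u = {v}"
      using leaf_neighbours_singleton[of u] by auto
    have "{u, v} = verts G"
      using Nu Nv uV vV by (intro indecomposableD[OF conn, of _ u]) auto
    moreover have "card {u, v} \<le> 2"
      by (simp add: card_insert_if)
    ultimately have "card (verts G) \<le> 2"
      by simp
    then show False
      using card_verts k3 by linarith
  qed
qed

lemma card_inner_leaf_neighbours:
  assumes "v \<in> inner"
  shows "card (neighbours G v \<inter> inner) + card (neighbours G v \<inter> leaves) = 3"
proof -
  have "neighbours G v = (neighbours G v \<inter> inner) \<union> (neighbours G v \<inter> leaves)"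
    using neighbours_subset_verts[of v] verts_split(1) by blast
  then have "card (neighbours G v) = card (neighbours G v \<inter> inner) + card (neighbours G v \<inter> leaves)"
    using verts_split(2) by (metis card_Un_disjoint finite_Int finite_neighbours inf_bot_right
        inf_left_commute inf_commute)
  with assms show ?thesis
    by (simp add: inner_def)
qed

lemma double_count:
  assumes "finite A" "finite B"
  shows "(\<Sum>a\<in>A. card (neighbours G a \<inter> B)) = (\<Sum>b\<in>B. card (neighbours G b \<inter> A))"
proof -
  have count: "card (neighbours G a \<inter> B) = (\<Sum>b\<in>B. if b \<in> neighbours G a then 1 else 0)"
    if "finite B" for a B
    using that by (simp add: sum.If_cases Int_commute)
  have "(\<Sum>a\<in>A. card (neighbours G a \<inter> B)) = (\<Sum>a\<in>A. \<Sum>b\<in>B. if b \<in> neighbours G a then 1 else 0)"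
    using assms by (simp only: count)
  also have "\<dots> = (\<Sum>b\<in>B. \<Sum>a\<in>A. if b \<in> neighbours G a then 1 else 0)"
    by (rule sum.swap)
  also have "\<dots> = (\<Sum>b\<in>B. \<Sum>a\<in>A. if a \<in> neighbours G b then 1 else 0)"
    by (intro sum.cong refl) (simp only: neighbours_sym)
  also have "\<dots> = (\<Sum>b\<in>B. card (neighbours G b \<inter> A))"
    using assms by (simp only: count)
  finally show ?thesis .
qed

text \<open>Each of the k leaves has its only neighbour inside, so k of the 3 (k - 2) arcs starting
  at inner vertices lead to leaves. What remains is the degree sum of a tree on
  \<open>inner\<close>.\<close>

lemma sum_inner_degree: "(\<Sum>v\<in>inner. card (neighbours G v \<inter> inner)) + 2 = 2 * card inner"
proof -
  have "card (neighbours G v \<inter> inner) = 1" if "v \<in> leaves" for v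
  proof -
    obtain u where "neighbours G v = {u}"
      using leaf_neighbours_singleton[OF \<open>v \<in> leaves\<close>] by blast
    with leaf_neighbour(2)[OF that, of u] show ?thesis
      by simp
  qed
  then have "(\<Sum>v\<in>inner. card (neighbours G v \<inter> leaves)) = card leaves"
    unfolding double_count[OF finite_inner finite_leaves] by simp
  moreover have "(\<Sum>v\<in>inner. card (neighbours G v \<inter> inner) + card (neighbours G v \<inter> leaves)) =
      (\<Sum>v\<in>inner. 3)"
    using card_inner_leaf_neighbours by (intro sum.cong) auto
  ultimately have "(\<Sum>v\<in>inner. card (neighbours G v \<inter> inner)) + k = 3 * (k - 2)"
    by (simp add: sum.distrib card_leaves card_inner)
  then show ?thesis
    unfolding card_inner using k3 by linarith
qed

text \<open>All neighbours of \<open>v\<close> are leaves, so \<open>v\<close> with its neighbours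
  is closed and is the whole graph.\<close>

lemma isolated_inner:
  assumes v: "v \<in> inner" and no: "neighbours G v \<inter> inner = {}"
  shows "inner = {v}"
proof -
  have leaf: "u \<in> leaves" if "u \<in> neighbours G v" for u
    using that no neighbours_subset_verts[of v] verts_split(1) by blast
  have "insert v (neighbours G v) = verts G"
  proof (rule indecomposableD[OF conn, of _ v])
    show "insert v (neighbours G v) \<subseteq> verts G"
      using v neighbours_subset_verts[of v] by (simp add: inner_def)
    fix u assume "u \<in> insert v (neighbours G v)"
    then show "neighbours G u \<subseteq> insert v (neighbours G v)"
      using leaf_neighbour(1)[OF leaf, of u v] neighbours_sym[of u v] by blast
  qed simp
  then show ?thesis
    using v leaf inner_not_leaf verts_split(1) by blast
qed

text \<open>Inner vertices have degree 3, so at most one inner neighbour means at least two leaves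
  attached.\<close>

definition twin_supports :: "'a set" where
  "twin_supports = {v \<in> inner. card (neighbours G v \<inter> inner) \<le> 1}"

text \<open>
  If two leaves hang from the same vertex, the function that is \<open>1\<close> on one of them, \<open>- 1\<close> on the
  other and zero elsewhere is an eigenfunction of the Laplacian for the eigenvalue \<open>1\<close>.
\<close>

lemma twin_leaf_eigenfunctions:
  obtains u :: "'a \<Rightarrow> 'a \<Rightarrow> complex" where
    "\<forall>v\<in>twin_supports. \<forall>x\<in>verts G. lap G (u v) x = 1 * u v x"
    "\<forall>c. (\<forall>x\<in>verts G. (\<Sum>v\<in>twin_supports. c v * u v x) = 0) \<longrightarrow> (\<forall>v\<in>twin_supports. c v = 0)"
proof -
  have "\<exists>a b. a \<noteq> b \<and> a \<in> neighbours G v \<inter> leaves \<and> b \<in> neighbours G v \<inter> leaves"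
    if "v \<in> twin_supports" for v
  proof -
    have "2 \<le> card (neighbours G v \<inter> leaves)"
      using that card_inner_leaf_neighbours[of v] by (auto simp: twin_supports_def)
    then obtain T where "T \<subseteq> neighbours G v \<inter> leaves" "card T = 2"
      by (rule obtain_subset_with_card_n)
    then show ?thesis
      unfolding card_2_iff by blast
  qed
  then obtain a b where ab: "\<And>v. v \<in> twin_supports \<Longrightarrow>
      a v \<noteq> b v \<and> a v \<in> neighbours G v \<inter> leaves \<and> b v \<in> neighbours G v \<inter> leaves"
    by metis
  have nb: "neighbours G (a v) = {v}" "neighbours G (b v) = {v}" if "v \<in> twin_supports" for v
    using ab[OF that] leaf_neighbour(1)[of _ v] neighbours_sym[of v] by blast+
  define u where "u = (\<lambda>v x. if x = a v then 1 else if x = b v then - 1 else 0 :: complex)"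
  show ?thesis
  proof (rule that[of u]; intro ballI allI impI)
    fix v x assume v: "v \<in> twin_supports" and x: "x \<in> verts G"
    \<comment> \<open>Both chosen leaves are seen from \<open>v\<close> only, so their opposite
      values cancel in every neighbour sum.\<close>
    have mem: "a v \<in> neighbours G x \<longleftrightarrow> x = v" "b v \<in> neighbours G x \<longleftrightarrow> x = v"
      using nb[OF v] neighbours_sym[of _ x] by blast+
    have "(\<Sum>y\<in>neighbours G x. u v y) =
        (\<Sum>y\<in>neighbours G x. (if y = a v then 1 else 0) - (if y = b v then 1 else 0))"
      using ab[OF v] by (intro sum.cong) (auto simp: u_def)
    then have zero: "(\<Sum>y\<in>neighbours G x. u v y) = 0"
      by (simp add: sum_subtractf mem)
    \<comment> \<open>Only the degree term is left: a leaf has degree 1, and at all other vertices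
      the function is zero.\<close>
    show "lap G (u v) x = 1 * u v x"
    proof (cases "x \<in> leaves")
      case True
      then show ?thesis
        by (simp add: lap_def zero leaves_def)
    next
      case False
      then have "u v x = 0"
        using ab[OF v] by (auto simp: u_def)
      then show ?thesis
        by (simp add: lap_def zero)
    qed
  next
    fix c :: "'a \<Rightarrow> complex" and v
    assume c: "\<forall>x\<in>verts G. (\<Sum>v\<in>twin_supports. c v * u v x) = 0" and v: "v \<in> twin_supports"
    show "c v = 0"
    proof -
      have fin: "finite twin_supports"
        by (simp add: twin_supports_def)
      \<comment> \<open>A leaf has a single support, so at \<open>a v\<close> every function other
        than that of \<open>v\<close> vanishes.\<close>
      have "c w * u w (a v) = (if w = v then c v else 0)" if "w \<in> twin_supports" for w
      proof (cases "w = v")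
        case False
        then have "a v \<noteq> a w" "a v \<noteq> b w"
          using nb[OF v] nb[OF that] by auto
        with False show ?thesis
          by (simp add: u_def)
      qed (simp add: u_def)
      then have "(\<Sum>w\<in>twin_supports. c w * u w (a v)) = (\<Sum>w\<in>twin_supports. if w = v then c v else 0)"
        by (intro sum.cong) auto
      also have "\<dots> = c v"
        using v fin by simp
      finally show "c v = 0"
        using c ab[OF v] by (auto simp: leaves_def)
    qed
  qed
qed

text \<open>The excesses \<open>j v - 2\<close> sum to -2. Only twin supports are negative, each by
  exactly 1, and there are at most two; a vertex with three inner neighbours would push the sum to
  -1 or more.\<close>

lemma inner_degree_le_two:
  assumes twin: "card twin_supports \<le> 2" and x: "x \<in> inner"
  shows "card (neighbours G x \<inter> inner) \<le> 2"
proof (rule ccontr)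
  assume "\<not> card (neighbours G x \<inter> inner) \<le> 2"
  then have x3: "card (neighbours G x \<inter> inner) \<ge> 3"
    by simp
  define j where "j = (\<lambda>v. int (card (neighbours G v \<inter> inner)))"
  \<comment> \<open>An inner vertex without inner neighbours would be the only inner vertex, hence
    \<open>x\<close>, which has three.\<close>
  have "j v \<ge> 1" if "v \<in> inner" for v
  proof (rule ccontr)
    assume "\<not> j v \<ge> 1"
    then have "card (neighbours G v \<inter> inner) = 0"
      unfolding j_def by linarith
    then have no: "neighbours G v \<inter> inner = {}"
      by (simp add: card_eq_0_iff)
    with isolated_inner[OF that] x have "x = v"
      by blast
    then show False
      using x3 no by simp
  qed
  then have "(if v \<in> twin_supports then - 1 else 0) + (if v = x then 1 else 0) \<le> j v - 2"
    if "v \<in> inner" for v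
    using that x3 by (auto simp: j_def twin_supports_def)
  then have "(\<Sum>v\<in>inner. (if v \<in> twin_supports then - 1 else 0) + (if v = x then 1 else 0)) \<le>
      (\<Sum>v\<in>inner. j v - 2)"
    by (rule sum_mono)
  moreover have "(\<Sum>v\<in>inner. (if v \<in> twin_supports then - 1 else 0) + (if v = x then 1 else 0 :: int)) =
      1 - int (card twin_supports)"
  proof -
    have "inner \<inter> twin_supports = twin_supports"
      by (auto simp: twin_supports_def)
    then show ?thesis
      using x by (simp add: sum.distrib sum.If_cases)
  qed
  moreover have "(\<Sum>v\<in>inner. j v - 2) = - 2"
    using arg_cong[OF sum_inner_degree, of int] by (simp add: j_def sum_subtractf)
  ultimately show False
    using twin by linarith
qed

lemma inner_path:
  assumes twin: "card twin_supports \<le> 2"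
  obtains xs where "distinct xs" "set xs = inner"
    "\<forall>i. Suc i < length xs \<longrightarrow> xs ! Suc i \<in> neighbours G (xs ! i)"
    "\<forall>i<length xs. \<forall>y\<in>neighbours G (xs ! i) \<inter> inner.
       (Suc i < length xs \<and> y = xs ! Suc i) \<or> (0 < i \<and> y = xs ! (i - 1))"
proof -
  \<comment> \<open>Emptiness off \<open>inner\<close> keeps \<open>nb\<close> symmetric: a leaf
    would otherwise list its support without being listed by it.\<close>
  define nb where "nb = (\<lambda>v. if v \<in> inner then neighbours G v \<inter> inner else {})"
  \<comment> \<open>The average inner degree is below 2, which yields an endpoint.\<close>
  have "\<exists>w\<in>inner. card (nb w) \<le> 1"
  proof (rule ccontr)
    assume "\<not> ?thesis"
    then have "(\<Sum>v\<in>inner. 2) \<le> (\<Sum>v\<in>inner. card (neighbours G v \<inter> inner))"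
      by (intro sum_mono) (auto simp: nb_def not_le)
    then show False
      using sum_inner_degree by simp
  qed
  then obtain w where w: "w \<in> inner" "card (nb w) \<le> 1"
    by blast
  obtain xs where xs: "distinct xs" "set xs = inner"
    "\<And>i. Suc i < length xs \<Longrightarrow> xs ! Suc i \<in> nb (xs ! i)"
    "\<And>i y. \<lbrakk>i < length xs; y \<in> nb (xs ! i)\<rbrakk> \<Longrightarrow>
       (Suc i < length xs \<and> y = xs ! Suc i) \<or> (0 < i \<and> y = xs ! (i - 1))"
  proof (rule path_enumeration[of inner nb w])
    show "finite (nb v)" "v \<notin> nb v" for v
      by (simp_all add: nb_def)
    show "v \<in> nb u" if "u \<in> nb v" for u v
      using that neighbours_sym[of u v] by (auto simp: nb_def split: if_splits)
    show "nb v \<subseteq> inner" for v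
      by (simp add: nb_def)
    show "card (nb v) \<le> 2" for v
      using inner_degree_le_two[OF twin, of v] by (simp add: nb_def)
    fix S assume S: "S \<subseteq> inner" "S \<noteq> {}" "\<And>v. v \<in> S \<Longrightarrow> nb v \<subseteq> S"
    \<comment> \<open>Adding the leaves attached to \<open>S\<close> makes it closed in
      \<open>G\<close>, so connectedness of \<open>G\<close> passes to the inner vertices.\<close>
    define T where "T = S \<union> {u \<in> leaves. \<exists>v\<in>S. u \<in> neighbours G v}"
    obtain s where "s \<in> S"
      using S(2) by blast
    have "T = verts G"
    proof (rule indecomposableD[OF conn, of _ s])
      show "T \<subseteq> verts G"
        using S(1) verts_split(1) by (auto simp: T_def)
      show "s \<in> T"
        using \<open>s \<in> S\<close> by (simp add: T_def)
      fix v assume "v \<in> T"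
      then consider "v \<in> S" | z where "v \<in> leaves" "z \<in> S" "v \<in> neighbours G z"
        by (auto simp: T_def)
      then show "neighbours G v \<subseteq> T"
      proof cases
        case 1
        have "y \<in> T" if y: "y \<in> neighbours G v" for y
        proof (cases "y \<in> inner")
          case True
          then show ?thesis
            using S(1) S(3)[OF 1] 1 y by (auto simp: T_def nb_def split: if_splits)
        next
          case False
          then have "y \<in> leaves"
            using y neighbours_subset_verts[of v] verts_split(1) by blast
          then show ?thesis
            using 1 y by (auto simp: T_def)
        qed
        then show ?thesis
          by blast
      next
        case 2
        then have "neighbours G v = {z}"
          using leaf_neighbour(1)[of v z] neighbours_sym[of v z] by blast
        then show ?thesis
          using 2 by (simp add: T_def)
      qed
    qed
    then have "inner \<subseteq> T"
      using verts_split(1) by blast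
    then show "S = inner"
      using S(1) inner_not_leaf by (auto simp: T_def)
  qed (use w in auto)
  show ?thesis
  proof (rule that[OF xs(1,2)], intro allI impI)
    fix i assume "Suc i < length xs"
    from xs(3)[OF this] show "xs ! Suc i \<in> neighbours G (xs ! i)"
      by (simp add: nb_def split: if_splits)
  next
    show "\<forall>i<length xs. \<forall>y\<in>neighbours G (xs ! i) \<inter> inner.
       (Suc i < length xs \<and> y = xs ! Suc i) \<or> (0 < i \<and> y = xs ! (i - 1))"
    proof (intro allI impI ballI)
      fix i y assume "i < length xs" "y \<in> neighbours G (xs ! i) \<inter> inner"
      then show "(Suc i < length xs \<and> y = xs ! Suc i) \<or> (0 < i \<and> y = xs ! (i - 1))"
        using xs(2) nth_mem[of i xs] by (intro xs(4)) (auto simp: nb_def)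
    qed
  qed
qed

text \<open>The inner path, prolonged by a leaf at each end, is the image of the path vertices, and
  the remaining neighbour of each inner vertex is the image of its pendant vertex.\<close>

lemma centipede_embedding:
  assumes twin: "card twin_supports \<le> 2"
  obtains \<psi> where "inj_on \<psi> (pverts (centipede k))" "\<psi> ` pverts (centipede k) \<subseteq> verts G"
    "\<forall>u v. (u, v) \<in> parcs (centipede k) \<longrightarrow> \<psi> v \<in> neighbours G (\<psi> u)"
proof -
  obtain xs where dist: "distinct xs" and xsI: "set xs = inner"
    and steps: "\<forall>i. Suc i < length xs \<longrightarrow> xs ! Suc i \<in> neighbours G (xs ! i)"
    and inner_nbrs: "\<forall>i<length xs. \<forall>y\<in>neighbours G (xs ! i) \<inter> inner.
       (Suc i < length xs \<and> y = xs ! Suc i) \<or> (0 < i \<and> y = xs ! (i - 1))"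
    using inner_path[OF twin] .
  have step: "xs ! Suc i \<in> neighbours G (xs ! i)" if "Suc i < length xs" for i
    using steps that by blast
  have nbrs: "(Suc i < length xs \<and> y = xs ! Suc i) \<or> (0 < i \<and> y = xs ! (i - 1))"
    if "i < length xs" "y \<in> neighbours G (xs ! i)" "y \<in> inner" for i y
    using inner_nbrs that by blast
  have len: "length xs = k - 2"
    using distinct_card[OF dist] xsI card_inner by simp
  have xs_inner: "xs ! i \<in> inner" if "i < k - 2" for i
    using that len xsI nth_mem[of i xs] by simp
  have third: "\<exists>y. y \<in> neighbours G v - {s, t}" if "v \<in> inner" for v s t
  proof -
    have "card {s, t} < card (neighbours G v)"
      using that by (simp add: inner_def card_insert_if)
    then show ?thesis
      using card_mono[of "{s, t}" "neighbours G v"] by (meson DiffI finite.emptyI finite.insertI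
          linorder_not_less subsetI)
  qed
  have leafI: "y \<in> leaves" if "y \<in> neighbours G v" "y \<notin> inner" for y v
    using that neighbours_subset_verts[of v] verts_split(1) by blast
  \<comment> \<open>Only the successor has to be avoided, so it is listed twice. For k = 3 the index
    is out of range and the unspecified value does no harm.\<close>
  obtain a where a: "a \<in> neighbours G (xs ! 0) - {xs ! Suc 0, xs ! Suc 0}"
    using third[OF xs_inner[of 0]] k3 by fastforce
  define l where "l = k - 3"
  have l: "l < k - 2" "Suc l = k - 2"
    using k3 by (auto simp: l_def)
  \<comment> \<open>Avoiding \<open>a\<close> matters for k = 3, where both ends are attached to the
    same inner vertex.\<close>
  obtain b where b: "b \<in> neighbours G (xs ! l) - {xs ! (l - 1), a}"
    using third[OF xs_inner[OF l(1)]] by blast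
  have a_leaf: "a \<in> leaves"
    using a nbrs[of 0 a] len k3 by (intro leafI[of a "xs ! 0"]) auto
  have b_leaf: "b \<in> leaves"
    using b nbrs[of l b] len l by (intro leafI[of b "xs ! l"]) auto
  \<comment> \<open>Position 0 is taken by the leaf \<open>a\<close>, so the inner path is shifted
    by one.\<close>
  define q where "q = (\<lambda>i. if i = 0 then a else if i = k - 1 then b else xs ! (i - 1))"
  have q0: "q 0 = a" and qk: "q (k - 1) = b"
    using k3 by (auto simp: q_def)
  have qi: "q i = xs ! (i - 1)" if "1 \<le> i" "i < k - 1" for i
    using that by (simp add: q_def)
  have q_inner: "q i \<in> inner" if "1 \<le> i" "i < k - 1" for i
    unfolding qi[OF that] using that by (intro xs_inner) linarith
  have q_step: "q (Suc i) \<in> neighbours G (q i)" if "Suc i < k" for i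
  proof -
    consider "i = 0" | "1 \<le> i" "Suc i < k - 1" | "1 \<le> i" "Suc i = k - 1"
      using \<open>Suc i < k\<close> by linarith
    then show ?thesis
    proof cases
      case 1
      have "q (Suc 0) = xs ! 0"
        using qi[of 1] k3 by simp
      with 1 show ?thesis
        using a neighbours_sym[of a "xs ! 0"] by (simp add: q0)
    next
      case 2
      then have "q i = xs ! (i - 1)" "q (Suc i) = xs ! Suc (i - 1)"
        using qi[of i] qi[of "Suc i"] by auto
      then show ?thesis
        using step[of "i - 1"] 2 len by auto
    next
      case 3
      then have "i - 1 = l"
        by (simp add: l_def)
      then have "q i = xs ! l"
        using qi[of i] 3 by simp
      moreover have "q (Suc i) = b"
        using qk 3 by simp
      ultimately show ?thesis
        using b by simp
    qed
  qed
  have q_inj: "i = j" if ij: "i < k" "j < k" "q i = q j" for i j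
  proof -
    have ne: "q i \<noteq> q j" if "i < j" "j < k" for i j
    proof -
      consider "i = 0" "j = k - 1" | "i = 0" "1 \<le> j" "j < k - 1" | "1 \<le> i" "i < k - 1" "j = k - 1"
        | "1 \<le> i" "i < k - 1" "1 \<le> j" "j < k - 1"
        using \<open>i < j\<close> \<open>j < k\<close> by linarith
      then show ?thesis
      proof cases
        case 1
        then show ?thesis
          using q0 qk b by auto
      next
        case 2
        then show ?thesis
          using q0 q_inner[of j] a_leaf inner_not_leaf by auto
      next
        case 3
        then show ?thesis
          using qk q_inner[of i] b_leaf inner_not_leaf by auto
      next
        case 4
        then have "xs ! (i - 1) \<noteq> xs ! (j - 1)"
          using dist len \<open>i < j\<close> by (subst nth_eq_iff_index_eq) auto
        then show ?thesis
          using qi 4 by simp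
      qed
    qed
    show ?thesis
      using ne[of i j] ne[of j i] ij by (cases i j rule: linorder_cases) auto
  qed
  have "\<forall>i. \<exists>y. 1 \<le> i \<and> i < k - 1 \<longrightarrow> y \<in> neighbours G (q i) - {q (i - 1), q (Suc i)}"
    using third q_inner by blast
  then obtain r where r: "\<And>i. \<lbrakk>1 \<le> i; i < k - 1\<rbrakk> \<Longrightarrow> r i \<in> neighbours G (q i) - {q (i - 1), q (Suc i)}"
    by metis
  have r_leaf: "r i \<in> leaves" if i: "1 \<le> i" "i < k - 1" for i
  proof (rule leafI)
    show "r i \<in> neighbours G (q i)"
      using r[OF i] by simp
    show "r i \<notin> inner"
    proof
      assume "r i \<in> inner"
      then have "(Suc (i - 1) < length xs \<and> r i = xs ! Suc (i - 1)) \<or> (0 < i - 1 \<and> r i = xs ! (i - 1 - 1))"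
        using r[OF i] qi[OF i] i len by (intro nbrs) auto
      then show False
      proof (elim disjE conjE)
        assume "Suc (i - 1) < length xs" "r i = xs ! Suc (i - 1)"
        then have "r i = q (Suc i)"
          using qi[of "Suc i"] i len by simp
        then show False
          using r[OF i] by simp
      next
        assume "0 < i - 1" "r i = xs ! (i - 1 - 1)"
        then have "r i = q (i - 1)"
          using qi[of "i - 1"] i by simp
        then show False
          using r[OF i] by simp
      qed
    qed
  qed
  have r_nbr: "neighbours G (r i) = {q i}" if i: "1 \<le> i" "i < k - 1" for i
    using leaf_neighbour(1)[OF r_leaf[OF i], of "q i"] r[OF i] neighbours_sym[of "r i" "q i"] by blast
  \<comment> \<open>Since \<open>r j\<close> is a leaf, a coincidence can occur only at an end of
    the path. A leaf has one support, so \<open>q j\<close> is next to that end, and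
    \<open>r j\<close> was chosen to differ from it.\<close>
  have q_ne_r: "q i \<noteq> r j" if "i < k" "1 \<le> j" "j < k - 1" for i j
  proof
    assume eq: "q i = r j"
    have nbr: "neighbours G (q i) = {q j}"
      unfolding eq using that by (intro r_nbr)
    consider "i = 0" | "i = k - 1" | "1 \<le> i" "i < k - 1"
      using \<open>i < k\<close> by linarith
    then show False
    proof cases
      case 1
      have "q (Suc 0) \<in> {q j}"
        using q_step[of 0] nbr 1 k3 by simp
      then have "j = 1"
        using q_inj[of "Suc 0" j] that k3 by simp
      then show False
        using r[of 1] that eq 1 by simp
    next
      case 2
      have "q (k - 1) \<in> neighbours G (q (k - 2))"
        using q_step[of "k - 2"] k3 by (simp add: Suc_diff_Suc numeral_eq_Suc)
      then have "q (k - 2) \<in> {q j}"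
        using neighbours_sym[of "q (k - 1)" "q (k - 2)"] nbr 2 by blast
      then have "j = k - 2"
        using q_inj[of "k - 2" j] that k3 by simp
      then have "Suc j = k - 1"
        using k3 by simp
      then show False
        using r[of j] that eq 2 by simp
    next
      case 3
      then show False
        using q_inner[of i] r_leaf[of j] that eq inner_not_leaf by auto
    qed
  qed
  have r_inj: "i = j" if "1 \<le> i" "i < k - 1" "1 \<le> j" "j < k - 1" "r i = r j" for i j
    using r_nbr[of i] r_nbr[of j] that q_inj[of i j] by simp
  have k2: "k \<ge> 2"
    using k3 by simp
  show ?thesis
  proof (rule that[of "case_sum q r"])
    show "inj_on (case_sum q r) (pverts (centipede k))"
    proof (rule inj_onI)
      fix x y assume "x \<in> pverts (centipede k)" "y \<in> pverts (centipede k)"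
        "case_sum q r x = case_sum q r y"
      then show "x = y"
        using q_inj r_inj q_ne_r q_ne_r[symmetric] unfolding pverts_centipede[OF k2] by fastforce
    qed
    have q_verts: "q i \<in> verts G" if "i < k" for i
    proof (cases "i = 0 \<or> i = k - 1")
      case True
      then show ?thesis
        using q0 qk a_leaf b_leaf verts_split(1) by auto
    next
      case False
      then show ?thesis
        using q_inner[of i] that verts_split(1) by auto
    qed
    have r_verts: "r i \<in> verts G" if "1 \<le> i" "i < k - 1" for i
      using r_leaf[OF that] by (simp add: leaves_def)
    show "case_sum q r ` pverts (centipede k) \<subseteq> verts G"
    proof
      fix x assume "x \<in> case_sum q r ` pverts (centipede k)"
      then consider i where "i < k" "x = q i" | i where "1 \<le> i" "i < k - 1" "x = r i"
        unfolding pverts_centipede[OF k2] by auto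
      then show "x \<in> verts G"
        by cases (use q_verts r_verts in blast)+
    qed
    show "\<forall>u v. (u, v) \<in> parcs (centipede k) \<longrightarrow> case_sum q r v \<in> neighbours G (case_sum q r u)"
    proof (intro allI impI)
      fix u v assume "(u, v) \<in> parcs (centipede k)"
      then consider i where "u = Inl i" "v = Inl (Suc i)" "Suc i < k"
        | i where "u = Inl (Suc i)" "v = Inl i" "Suc i < k"
        | i where "u = Inl i" "v = Inr i" "1 \<le> i" "i < k - 1"
        | i where "u = Inr i" "v = Inl i" "1 \<le> i" "i < k - 1"
        unfolding parcs_centipede[OF k2] by auto
      then show "case_sum q r v \<in> neighbours G (case_sum q r u)"
      proof cases
        case 1
        then show ?thesis
          using q_step by simp
      next
        case (2 i)
        then show ?thesis
          using q_step[of i] neighbours_sym[of "q i"] by simp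
      next
        case 3
        then show ?thesis
          using r by simp
      next
        case 4
        then show ?thesis
          using r_nbr by simp
      qed
    qed
  qed
qed

end

theorem theorem5:
  fixes k :: nat and G :: "('a, 'b) pre_digraph"
  assumes "k \<ge> 2"
    and "graph G"
    and "laplacian_spectrum G = laplacian_spectrum (with_proj (centipede k))"
  shows "digraph_iso G (with_proj (centipede k))"
proof -
  let ?C = "centipede k"
  note k = assms(1)
  have gC: "graph (with_proj ?C)"
    by (rule graph_centipede[OF k])
  interpret cospectral_graphs G "with_proj ?C"
    using assms(2,3) gC by (simp add: cospectral_graphs_def cospectral_graphs_axioms_def)
  have card: "card (verts G) = 2 * k - 2"
    using card_verts_eq card_centipede[OF k] by simp
  have sum: "(\<Sum>v\<in>verts G. card (neighbours G v)) = 4 * k - 6"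
    using sum_degree_eq sum_degree_centipede[OF k] by simp
  have ends: "Inl 0 \<in> pverts ?C" "Inl (k - 1) \<in> pverts ?C"
    using k by (auto simp: pverts_centipede[OF k])
  have conn: "indecomposable G"
    by (rule indecomposable_if_harmonic_constant[of "Inl 0"])
      (use ends harmonic_centipede[OF k] in simp_all)
  have ne: "verts G \<noteq> {}"
    using card k by auto
  have nonisolated: "neighbours G v \<noteq> {}" if "v \<in> verts G" for v
  proof
    assume "neighbours G v = {}"
    then have "{v} = verts G"
      using that by (intro indecomposableD[OF conn, of _ v]) auto
    then have "card (verts G) = 1"
      by (metis One_nat_def card.empty card.insert empty_iff finite.emptyI)
    then show False
      using card k by simp
  qed
  have tree: "(\<Sum>v\<in>verts G. card (neighbours G v)) = 2 * (card (verts G) - 1)"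
    using card sum k by simp
  have deg: "card (neighbours G v) \<in> {1, 3}" if "v \<in> verts G" for v
    using _ triangle_free_centipede[OF k] G.triangle_free_if_tree[OF conn ne tree] nonisolated that
    by (rule degrees_one_or_three) (use degrees_centipede[OF k] in simp)
  obtain \<psi> where \<psi>: "inj_on \<psi> (pverts ?C)" "\<psi> ` pverts ?C \<subseteq> verts G"
    "\<forall>u v. (u, v) \<in> parcs ?C \<longrightarrow> \<psi> v \<in> neighbours G (\<psi> u)"
  \<comment> \<open>For k = 2 the centipede is a single edge, and two vertices without isolated ones
    already form it.\<close>
  proof (cases "k = 2")
    case True
    then have "card (verts G) = 2"
      using card by simp
    then obtain a b where ab: "verts G = {a, b}" "a \<noteq> b"
      by (auto simp: card_2_iff)
    then have "neighbours G a = {b}"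
      using nonisolated[of a] G.neighbours_subset_verts[of a] G.not_self_neighbour[of a] by auto
    then have nb: "b \<in> neighbours G a" "a \<in> neighbours G b"
      using G.neighbours_sym[of a b] by auto
    have C: "pverts ?C = {Inl 0, Inl 1}" "parcs ?C = {(Inl 0, Inl 1), (Inl 1, Inl 0)}"
      unfolding pverts_centipede[OF k] parcs_centipede[OF k] using True by auto
    show ?thesis
      by (rule that[of "\<lambda>v. if v = Inl 0 then a else b"]) (use ab nb in \<open>auto simp: C\<close>)
  next
    case False
    interpret one_three_tree G k
      using False k conn deg card sum by unfold_locales auto
    obtain u :: "'a \<Rightarrow> 'a \<Rightarrow> complex" where
      eig: "\<forall>v\<in>twin_supports. \<forall>x\<in>verts G. lap G (u v) x = 1 * u v x" and
      indep: "\<forall>c. (\<forall>x\<in>verts G. (\<Sum>v\<in>twin_supports. c v * u v x) = 0) \<longrightarrow>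
        (\<forall>v\<in>twin_supports. c v = 0)"
      using twin_leaf_eigenfunctions .
    \<comment> \<open>The two vertices are the ends of the path, which determine the eigenfunctions
      of the centipede for 1.\<close>
    have "card twin_supports \<le> card {Inl 0 :: nat + nat, Inl (k - 1)}"
    proof (rule eigenfunction_bound)
      show "finite twin_supports"
        by (simp add: twin_supports_def)
      show "lap G (u v) x = 1 * u v x" if "v \<in> twin_supports" "x \<in> verts G" for v x
        using eig that by blast
      show "\<forall>v\<in>twin_supports. c v = 0"
        if "\<And>x. x \<in> verts G \<Longrightarrow> (\<Sum>v\<in>twin_supports. c v * u v x) = 0" for c
        using indep that by blast
      show "{Inl 0, Inl (k - 1)} \<subseteq> verts (with_proj ?C)"
        using ends by simp
      fix f v
      assume f: "\<And>v. v \<in> verts (with_proj ?C) \<Longrightarrow> lap (with_proj ?C) f v = 1 * f v"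
        and zero: "\<And>s. s \<in> {Inl 0, Inl (k - 1)} \<Longrightarrow> f s = 0" and v: "v \<in> verts (with_proj ?C)"
      show "f v = 0"
      proof (rule eigenvalue_one_centipede[OF k])
        show "lap (with_proj ?C) f v = 1 * f v" if "v \<in> pverts ?C" for v
          using f[of v] that by simp
        show "f (Inl 0) = 0" "f (Inl (k - 1)) = 0"
          by (rule zero, simp)+
        show "v \<in> pverts ?C"
          using v by simp
      qed
    qed
    also have "\<dots> \<le> 2"
      by (simp add: card_insert_if)
    finally have "card twin_supports \<le> 2" .
    from centipede_embedding[OF this] that show ?thesis .
  qed
  show ?thesis
    using assms(2) gC \<psi>(1,2)
    by (rule digraph_iso_from_embedding) (use card_verts_eq sum_degree_eq \<psi>(3) in simp_all)
qed

end
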